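(* Let $(\mathcal{X},d)$ be a complete separable metric space and $P_1,\dots,P_{J+1}$ Borel probability measures on $\mathcal{X}$ with $\mathbb{E}_{P_j}[d(Y,y_0)]<\infty$ for some $y_0\in\mathcal{X}$ and all $j$. Assume $\{P_2,\dots,P_{J+1}\}$ are affinely independent ($\sum_{j=2}^{J+1}\alpha_jP_j=0$ and $\sum_j\alpha_j=0$ imply all $\alpha_j=0$) and let $\eta>0$. For each $N$ and each $j\in\{1,\dots,J+1\}$ let $Y_j^{(1)},\dots,Y_j^{(N)}$ be i.i.d. draws from $P_j$ and $\hat P_{j,N}=\frac1N\sum_{k=1}^N\delta_{Y_j^{(k)}}$. Let $$\hat\lambda_N\in\arg\min_{\lambda\in\Delta^{J-1}}\Big[W_1\Big(\sum_{j=2}^{J+1}\lambda_j\hat P_{j,N},\hat P_{1,N}\Big)+\eta\sum_{j=2}^{J+1}\lambda_j\log\lambda_j\Big]$$ and let $\lambda^*$ be the unique minimizer over $\Delta^{J-1}$ of $Q_\eta(\lambda)=W_1(\sum_{j=2}^{J+1}\lambda_jP_j,P_1)+\eta\sum_{j=2}^{J+1}\lambda_j\log\lambda_j$. Then $\hat\lambda_N\to\lambda^*$ in probability as $N\to\infty$.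
   Context: $\Delta^{J-1}=\{\lambda\in\mathbb{R}^J:\lambda_j\ge0,\sum_{j=2}^{J+1}\lambda_j=1\}$ with coordinates indexed by $j=2,\dots,J+1$; $0\log0=0$. $W_1$ is the Wasserstein-1 distance; $\delta_y$ is the Dirac mass at $y$. *)

theory Defs
  imports "HOL-Probability.Probability"
begin

definition borel_prob :: "'a::metric_space measure \<Rightarrow> bool" where
  "borel_prob P \<longleftrightarrow> prob_space P \<and> sets P = sets borel"

definition couplings :: "'a::metric_space measure \<Rightarrow> 'a measure \<Rightarrow> ('a \<times> 'a) measure set" where
  "couplings \<mu> \<nu> = {\<pi>. prob_space \<pi> \<and> sets \<pi> = sets borel \<and>
       distr \<pi> borel fst = \<mu> \<and> distr \<pi> borel snd = \<nu>}"

text \<open>Wasserstein-1 distance (Kantorovich formulation, real-valued; finite under finite first moments).\<close>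
definition W1 :: "'a::metric_space measure \<Rightarrow> 'a measure \<Rightarrow> real" where
  "W1 \<mu> \<nu> = enn2real (INF \<pi>\<in>couplings \<mu> \<nu>. \<integral>\<^sup>+ p. ennreal (dist (fst p) (snd p)) \<partial>\<pi>)"

definition mixture :: "'i set \<Rightarrow> ('i \<Rightarrow> real) \<Rightarrow> ('i \<Rightarrow> 'a::metric_space measure) \<Rightarrow> 'a measure" where
  "mixture I w P = measure_of UNIV (sets borel) (\<lambda>A. \<Sum>i\<in>I. ennreal (w i) * emeasure (P i) A)"

definition empirical :: "nat \<Rightarrow> (nat \<Rightarrow> 'a::metric_space) \<Rightarrow> 'a measure" where
  "empirical N y = mixture {1..N} (\<lambda>_. 1 / real N) (\<lambda>k. return borel (y k))"

definition Simplex :: "nat \<Rightarrow> (nat \<Rightarrow> real) set" where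
  "Simplex J = {l. (\<forall>j\<in>{2..J+1}. 0 \<le> l j) \<and> (\<Sum>j=2..J+1. l j) = 1}"

text \<open>Entropy-regularised objective W1(sum_j l_j P_j, P_1) + eta sum_j l_j log l_j (0 log 0 = 0).\<close>
definition Q_obj :: "nat \<Rightarrow> real \<Rightarrow> (nat \<Rightarrow> 'a::metric_space measure) \<Rightarrow> (nat \<Rightarrow> real) \<Rightarrow> real" where
  "Q_obj J \<eta> P l = W1 (mixture {2..J+1} l P) (P 1) + \<eta> * (\<Sum>j=2..J+1. l j * ln (l j))"

definition affinely_indep :: "nat \<Rightarrow> (nat \<Rightarrow> 'a::metric_space measure) \<Rightarrow> bool" where
  "affinely_indep J P \<longleftrightarrow> (\<forall>\<alpha>::nat\<Rightarrow>real.
     (\<forall>A\<in>sets borel. (\<Sum>j=2..J+1. \<alpha> j * measure (P j) A) = 0) \<and> (\<Sum>j=2..J+1. \<alpha> j) = 0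
       \<longrightarrow> (\<forall>j\<in>{2..J+1}. \<alpha> j = 0))"

end

theory Submission
  imports Defs
begin

text \<open>
  Let \<open>T\<close> be a Borel map with finite range. Moving a coupling along \<open>T \<times> T\<close> turns it into a finite
  matrix; such a matrix can be adjusted to nearby marginals at a cost proportional to the total
  variation, and lifted back to a coupling of any two measures having these cell probabilities. Hence
  \<open>W1\<close> changes by at most the quantization errors \<open>\<integral> d(x, T x)\<close> of the measures involved plus
  \<open>D\<close> times the total variation of the cell probabilities, where \<open>D\<close> bounds the diameter of the
  range of \<open>T\<close>. For mixtures the bound is uniform in the weights.

  Simple functions converging to the identity make the quantization errors of \<open>P j\<close> as small as desired.
  The quantization error of the empirical measure has the same expectation, and its cell
  probabilities converge in \<open>L1\<close> at rate \<open>1 / sqrt N\<close>. By Markov's inequality the empirical objective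
  is uniformly close to \<open>Q_obj\<close> with high probability. The same estimate makes \<open>Q_obj\<close> continuous on
  the compact simplex, so its unique minimizer is well separated.
\<close>

subsection \<open>Perturbing finite transport plans\<close>

text \<open>Only mass that no longer fits the new marginals is rerouted. Its amount is at most the
  \<open>l1\<close> change of the two marginals and each rerouted unit costs at most
  \<open>D\<close>, while the kept part of the plan costs no more than before.\<close>

lemma finite_transport_perturb:
  fixes q c :: "'b \<Rightarrow> 'b \<Rightarrow> real" and p1 p2 p1' p2' :: "'b \<Rightarrow> real"
  assumes F: "finite F"
    and q0: "\<And>a b. 0 \<le> q a b"
    and row: "\<And>a. a \<in> F \<Longrightarrow> (\<Sum>b\<in>F. q a b) = p1 a"
    and col: "\<And>b. b \<in> F \<Longrightarrow> (\<Sum>a\<in>F. q a b) = p2 b"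
    and p1: "(\<Sum>a\<in>F. p1 a) = 1"
    and p1': "\<And>a. 0 \<le> p1' a" "(\<Sum>a\<in>F. p1' a) = 1"
    and p2': "\<And>a. 0 \<le> p2' a" "(\<Sum>a\<in>F. p2' a) = 1"
    and c: "\<And>a b. 0 \<le> c a b" "\<And>a b. a \<in> F \<Longrightarrow> b \<in> F \<Longrightarrow> c a b \<le> D"
  shows "\<exists>q'. (\<forall>a b. a \<in> F \<longrightarrow> b \<in> F \<longrightarrow> 0 \<le> q' a b) \<and>
    (\<forall>a\<in>F. (\<Sum>b\<in>F. q' a b) = p1' a) \<and> (\<forall>b\<in>F. (\<Sum>a\<in>F. q' a b) = p2' b) \<and>
    (\<Sum>a\<in>F. \<Sum>b\<in>F. q' a b * c a b) \<le> (\<Sum>a\<in>F. \<Sum>b\<in>F. q a b * c a b)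
      + D * ((\<Sum>a\<in>F. \<bar>p1 a - p1' a\<bar>) + (\<Sum>a\<in>F. \<bar>p2 a - p2' a\<bar>))"
proof -
  have p10: "0 \<le> p1 a" if "a \<in> F" for a using row[OF that] q0 by (metis sum_nonneg)
  have p20: "0 \<le> p2 a" if "a \<in> F" for a using col[OF that] q0 by (metis sum_nonneg)
  \<comment> \<open>For \<open>x = 0\<close> the quotient is 0 by convention, so the factor is 0;
    this is harmless because there is no mass to shrink.\<close>
  have scale: "0 \<le> min 1 (y / x)" "min 1 (y / x) \<le> 1" "min 1 (y / x) * x \<le> y"
    "(1 - min 1 (y / x)) * x \<le> \<bar>x - y\<bar>" if "0 \<le> x" "0 \<le> y" for x y :: real
    using that by (auto simp: min_def field_simps)
  txt \<open>Shrink row \<open>a\<close> by \<open>r a\<close> and column \<open>b\<close> by \<open>s b\<close> so that no new marginal is exceeded, then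
    distribute the missing mass \<open>m\<close> as a product of the residual marginals \<open>u\<close> and \<open>v\<close>.\<close>
  define r where "r a = min 1 (p1' a / p1 a)" for a
  define s where "s a = min 1 (p2' a / p2 a)" for a
  have r: "0 \<le> r a" "r a \<le> 1" "r a * p1 a \<le> p1' a" "(1 - r a) * p1 a \<le> \<bar>p1 a - p1' a\<bar>" if "a \<in> F" for a
    using scale[OF p10[OF that] p1'(1)] unfolding r_def by auto
  have s: "0 \<le> s a" "s a \<le> 1" "s a * p2 a \<le> p2' a" "(1 - s a) * p2 a \<le> \<bar>p2 a - p2' a\<bar>" if "a \<in> F" for a
    using scale[OF p20[OF that] p2'(1)] unfolding s_def by auto
  define k where "k a b = q a b * r a * s b" for a b
  have k0: "0 \<le> k a b" if "a \<in> F" "b \<in> F" for a b using that r s q0 by (simp add: k_def)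
  have kr: "k a b \<le> q a b * r a" if "a \<in> F" "b \<in> F" for a b
    using that r[of a] s[of b] q0[of a b] unfolding k_def by (intro mult_right_le_one_le) auto
  have ks: "k a b \<le> q a b * s b" if "a \<in> F" "b \<in> F" for a b
  proof -
    have "k a b = q a b * s b * r a" by (simp add: k_def)
    also have "\<dots> \<le> q a b * s b" using that r[of a] s[of b] q0[of a b] by (intro mult_right_le_one_le) auto
    finally show ?thesis .
  qed
  have kq: "k a b \<le> q a b" if "a \<in> F" "b \<in> F" for a b
    using kr[OF that] r[OF that(1)] q0[of a b] by (meson mult_right_le_one_le order_trans)
  define u where "u a = p1' a - (\<Sum>b\<in>F. k a b)" for a
  define v where "v b = p2' b - (\<Sum>a\<in>F. k a b)" for b
  define m where "m = 1 - (\<Sum>a\<in>F. \<Sum>b\<in>F. k a b)"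
  have u0: "0 \<le> u a" if "a \<in> F" for a
  proof -
    have "(\<Sum>b\<in>F. k a b) \<le> (\<Sum>b\<in>F. q a b * r a)" using kr that by (intro sum_mono) auto
    also have "\<dots> = p1 a * r a" using row[OF that] by (simp flip: sum_distrib_right)
    finally show ?thesis using r(3)[OF that] by (simp add: u_def mult.commute)
  qed
  have v0: "0 \<le> v b" if "b \<in> F" for b
  proof -
    have "(\<Sum>a\<in>F. k a b) \<le> (\<Sum>a\<in>F. q a b * s b)" using ks that by (intro sum_mono) auto
    also have "\<dots> = p2 b * s b" using col[OF that] by (simp flip: sum_distrib_right)
    finally show ?thesis using s(3)[OF that] by (simp add: v_def mult.commute)
  qed
  \<comment> \<open>Both residual marginals have the same total \<open>m\<close>, since both new
    marginals sum to 1. Hence the product of \<open>u\<close> and \<open>v\<close> divided by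
    \<open>m\<close> has exactly these marginals.\<close>
  have su: "(\<Sum>a\<in>F. u a) = m" by (simp add: u_def m_def sum_subtractf p1')
  have sv: "(\<Sum>a\<in>F. v a) = m"
    unfolding v_def m_def sum_subtractf p2' by (subst sum.swap) simp
  have m0: "0 \<le> m" using su u0 by (metis sum_nonneg)
  have uv0: "u a = 0" "v a = 0" if "m = 0" "a \<in> F" for a
    using that su sv u0 v0 F by (auto simp: sum_nonneg_eq_0_iff)
  txt \<open>If \<open>m = 0\<close>, the junk value of the quotient is correct because \<open>u\<close> and \<open>v\<close> vanish.\<close>
  define q' where "q' a b = k a b + u a * v b / m" for a b
  have sumq: "(\<Sum>a\<in>F. \<Sum>b\<in>F. q a b) = 1" using row p1 by simp
  have m_le: "m \<le> (\<Sum>a\<in>F. \<bar>p1 a - p1' a\<bar>) + (\<Sum>a\<in>F. \<bar>p2 a - p2' a\<bar>)"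
  proof -
    have "m = (\<Sum>a\<in>F. \<Sum>b\<in>F. q a b - k a b)" by (simp add: m_def sum_subtractf sumq)
    also have "\<dots> \<le> (\<Sum>a\<in>F. \<Sum>b\<in>F. q a b * (1 - r a) + q a b * (1 - s b))"
    proof (intro sum_mono)
      fix a b assume ab: "a \<in> F" "b \<in> F"
      \<comment> \<open>Expanding this product gives
        \<open>1 - r a * s b \<le> (1 - r a) + (1 - s b)\<close>, which separates the row loss from
        the column loss.\<close>
      have "0 \<le> (1 - r a) * (1 - s b)" using r[OF ab(1)] s[OF ab(2)] by simp
      then have "0 \<le> q a b * ((1 - r a) * (1 - s b))" using q0 by simp
      then show "q a b - k a b \<le> q a b * (1 - r a) + q a b * (1 - s b)"
        by (simp add: k_def algebra_simps)
    qed
    also have "\<dots> = (\<Sum>a\<in>F. (1 - r a) * p1 a) + (\<Sum>b\<in>F. (1 - s b) * p2 b)"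
    proof -
      have "(\<Sum>a\<in>F. \<Sum>b\<in>F. q a b * (1 - r a)) = (\<Sum>a\<in>F. (1 - r a) * p1 a)"
        by (intro sum.cong refl) (simp add: row[symmetric] sum_distrib_left mult.commute)
      moreover have "(\<Sum>a\<in>F. \<Sum>b\<in>F. q a b * (1 - s b)) = (\<Sum>b\<in>F. (1 - s b) * p2 b)"
        by (subst sum.swap, intro sum.cong refl) (simp add: col[symmetric] sum_distrib_left mult.commute)
      ultimately show ?thesis by (simp add: sum.distrib)
    qed
    also have "\<dots> \<le> (\<Sum>a\<in>F. \<bar>p1 a - p1' a\<bar>) + (\<Sum>a\<in>F. \<bar>p2 a - p2' a\<bar>)"
      by (intro add_mono sum_mono r s)
    finally show ?thesis .
  qed
  \<comment> \<open>The index set is nonempty because the masses sum to 1; a diagonal cost then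
    forces \<open>D\<close> to be nonnegative.\<close>
  obtain a0 where "a0 \<in> F" using p1 by (metis ex_in_conv sum.empty zero_neq_one)
  then have D0: "0 \<le> D" using c by (meson order_trans)
  show ?thesis
  proof (intro exI[of _ q'] conjI allI impI ballI)
    fix a b assume "a \<in> F" "b \<in> F" then show "0 \<le> q' a b"
      using k0 u0 v0 m0 by (simp add: q'_def)
  next
    fix a assume "a \<in> F"
    have "(\<Sum>b\<in>F. u a * v b / m) = u a * (\<Sum>b\<in>F. v b) / m"
      by (simp add: sum_distrib_left sum_divide_distrib)
    also have "\<dots> = u a" using uv0[of a] \<open>a \<in> F\<close> sv by (cases "m = 0") auto
    finally show "(\<Sum>b\<in>F. q' a b) = p1' a" by (simp add: q'_def sum.distrib u_def)
  next
    fix b assume "b \<in> F"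
    have "(\<Sum>a\<in>F. u a * v b / m) = (\<Sum>a\<in>F. u a) * v b / m"
      by (simp add: sum_distrib_right sum_divide_distrib)
    also have "\<dots> = v b" using uv0[of b] \<open>b \<in> F\<close> su by (cases "m = 0") auto
    finally show "(\<Sum>a\<in>F. q' a b) = p2' b" by (simp add: q'_def sum.distrib v_def)
  next
    have "(\<Sum>a\<in>F. \<Sum>b\<in>F. q' a b * c a b) \<le> (\<Sum>a\<in>F. \<Sum>b\<in>F. q a b * c a b + u a * v b / m * D)"
    proof (intro sum_mono)
      fix a b assume ab: "a \<in> F" "b \<in> F"
      have "k a b * c a b \<le> q a b * c a b" using kq ab c by (intro mult_right_mono) auto
      moreover have "u a * v b / m * c a b \<le> u a * v b / m * D"
        using ab c u0 v0 m0 by (intro mult_left_mono) auto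
      ultimately show "q' a b * c a b \<le> q a b * c a b + u a * v b / m * D"
        by (simp add: q'_def distrib_right)
    qed
    also have "\<dots> = (\<Sum>a\<in>F. \<Sum>b\<in>F. q a b * c a b) + (\<Sum>a\<in>F. u a) * (\<Sum>b\<in>F. v b) / m * D"
      by (simp only: sum.distrib sum_product) (simp only: sum_distrib_right sum_divide_distrib)
    also have "(\<Sum>a\<in>F. u a) * (\<Sum>b\<in>F. v b) / m = m" by (simp add: su sv)
    also have "m * D \<le> D * ((\<Sum>a\<in>F. \<bar>p1 a - p1' a\<bar>) + (\<Sum>a\<in>F. \<bar>p2 a - p2' a\<bar>))"
      using m_le D0 by (simp add: mult.commute[of m] mult_left_mono)
    finally show "(\<Sum>a\<in>F. \<Sum>b\<in>F. q' a b * c a b) \<le> (\<Sum>a\<in>F. \<Sum>b\<in>F. q a b * c a b)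
      + D * ((\<Sum>a\<in>F. \<bar>p1 a - p1' a\<bar>) + (\<Sum>a\<in>F. \<bar>p2 a - p2' a\<bar>))" by simp
  qed
qed

subsection \<open>Quantization and lifting of couplings\<close>

text \<open>Only the fibres of \<open>S\<close> have to be measurable, so \<open>h\<close> is
  arbitrary and the codomain carries no sigma-algebra. This form serves both \<open>T\<close> itself
  and the pair map \<open>T \<times> T\<close>.\<close>

lemma nn_integral_finite_valued:
  assumes "finite C" and S: "\<And>x. x \<in> space M \<Longrightarrow> S x \<in> C"
    and meas: "\<And>c. c \<in> C \<Longrightarrow> S -` {c} \<inter> space M \<in> sets M"
  shows "(\<integral>\<^sup>+x. h (S x) \<partial>M) = (\<Sum>c\<in>C. h c * emeasure M (S -` {c} \<inter> space M))"
proof -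
  have "(\<integral>\<^sup>+x. h (S x) \<partial>M) = (\<integral>\<^sup>+x. (\<Sum>c\<in>C. h c * indicator (S -` {c} \<inter> space M) x) \<partial>M)"
  proof (rule nn_integral_cong)
    fix x assume x: "x \<in> space M"
    have "(\<Sum>c\<in>C. h c * indicator (S -` {c} \<inter> space M) x) = (\<Sum>c\<in>C. if c = S x then h c else 0)"
      by (intro sum.cong refl) (auto simp: x)
    then show "h (S x) = (\<Sum>c\<in>C. h c * indicator (S -` {c} \<inter> space M) x)"
      using S[OF x] assms(1) by (simp add: sum.delta')
  qed
  also have "\<dots> = (\<Sum>c\<in>C. \<integral>\<^sup>+x. h c * indicator (S -` {c} \<inter> space M) x \<partial>M)"
    using meas by (intro nn_integral_sum) auto
  also have "\<dots> = (\<Sum>c\<in>C. h c * emeasure M (S -` {c} \<inter> space M))"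
    using meas by (intro sum.cong refl nn_integral_cmult_indicator) auto
  finally show ?thesis .
qed

lemma borel_probD:
  assumes "borel_prob \<mu>"
  shows "prob_space \<mu>" "sets \<mu> = sets borel" "space \<mu> = UNIV"
  using assms sets_eq_imp_space_eq[of \<mu> borel] by (auto simp: borel_prob_def)

lemma sum_measure_fibres:
  fixes T :: "'a::metric_space \<Rightarrow> 'a"
  assumes \<mu>: "borel_prob \<mu>" and T[measurable]: "T \<in> borel_measurable borel" and F: "finite (range T)"
  shows "(\<Sum>a\<in>range T. measure \<mu> (T -` {a})) = 1"
proof -
  interpret prob_space \<mu> using borel_probD[OF \<mu>] by simp
  have S: "T -` {a} \<in> sets \<mu>" for a
    using measurable_sets[OF T, of "{a}"] borel_probD[OF \<mu>] by simp
  have "(\<Sum>a\<in>range T. measure \<mu> (T -` {a})) = measure \<mu> (\<Union>a\<in>range T. T -` {a})"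
    using F S by (intro finite_measure_finite_Union[symmetric]) (auto simp: disjoint_family_on_def)
  also have "(\<Union>a\<in>range T. T -` {a}) = space \<mu>" using borel_probD[OF \<mu>] by auto
  finally show ?thesis by (simp add: prob_space)
qed

text \<open>The cells of \<open>T\<close> cut the product space into finitely many rectangles, and a
  row of rectangles fills up the preimage of a cell under \<open>fst\<close>. The matrix
  \<open>q\<close> is thus a finite transport plan, to which \<open>finite_transport_perturb\<close>
  applies.\<close>

lemma coupling_quantize:
  fixes T :: "'a::polish_space \<Rightarrow> 'a"
  assumes pi: "\<pi> \<in> couplings \<mu> \<nu>"
    and T[measurable]: "T \<in> borel_measurable borel" and F: "finite (range T)"
  defines "q \<equiv> \<lambda>a b. measure \<pi> (T -` {a} \<times> T -` {b})"
  shows "a \<in> range T \<Longrightarrow> (\<Sum>b\<in>range T. q a b) = measure \<mu> (T -` {a})"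
    and "b \<in> range T \<Longrightarrow> (\<Sum>a\<in>range T. q a b) = measure \<nu> (T -` {b})"
    and "(\<integral>\<^sup>+p. ennreal (dist (T (fst p)) (T (snd p))) \<partial>\<pi>) =
           ennreal (\<Sum>a\<in>range T. \<Sum>b\<in>range T. q a b * dist a b)"
proof -
  \<comment> \<open>In a Polish space the Borel sets of the product are generated by rectangles, so
    rectangles of cells are events for \<open>\<pi>\<close>.\<close>
  have \<pi>: "prob_space \<pi>" "sets \<pi> = sets (borel \<Otimes>\<^sub>M borel)" "distr \<pi> borel fst = \<mu>" "distr \<pi> borel snd = \<nu>"
    using pi unfolding couplings_def borel_prod by simp_all
  interpret prob_space \<pi> by fact
  note [measurable_cong] = \<pi>(2)
  have sp: "space \<pi> = UNIV" using sets_eq_imp_space_eq[OF \<pi>(2)] by (simp add: space_pair_measure)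
  have Tm: "T -` {a} \<in> sets borel" for a using measurable_sets[OF T, of "{a}"] by simp
  have S: "T -` {a} \<times> T -` {b} \<in> sets \<pi>" for a b
    unfolding \<pi>(2) using Tm by auto
  { fix a assume "a \<in> range T"
    have "(\<Sum>b\<in>range T. q a b) = measure \<pi> (\<Union>b\<in>range T. T -` {a} \<times> T -` {b})"
      unfolding q_def using F S by (intro finite_measure_finite_Union[symmetric]) (auto simp: disjoint_family_on_def)
    also have "(\<Union>b\<in>range T. T -` {a} \<times> T -` {b}) = fst -` (T -` {a}) \<inter> space \<pi>" using sp by auto
    also have "measure \<pi> \<dots> = measure \<mu> (T -` {a})"
      unfolding \<pi>(3)[symmetric] using Tm by (subst measure_distr) auto
    finally show "(\<Sum>b\<in>range T. q a b) = measure \<mu> (T -` {a})" . }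
  { fix b assume "b \<in> range T"
    have "(\<Sum>a\<in>range T. q a b) = measure \<pi> (\<Union>a\<in>range T. T -` {a} \<times> T -` {b})"
      unfolding q_def using F S by (intro finite_measure_finite_Union[symmetric]) (auto simp: disjoint_family_on_def)
    also have "(\<Union>a\<in>range T. T -` {a} \<times> T -` {b}) = snd -` (T -` {b}) \<inter> space \<pi>" using sp by auto
    also have "measure \<pi> \<dots> = measure \<nu> (T -` {b})"
      unfolding \<pi>(4)[symmetric] using Tm by (subst measure_distr) auto
    finally show "(\<Sum>a\<in>range T. q a b) = measure \<nu> (T -` {b})" . }
  have eq: "(\<lambda>p. (T (fst p), T (snd p))) -` {c} \<inter> space \<pi> = T -` {fst c} \<times> T -` {snd c}" for c
    using sp by auto
  have "(\<integral>\<^sup>+p. ennreal (dist (T (fst p)) (T (snd p))) \<partial>\<pi>) =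
      (\<Sum>c\<in>range T \<times> range T. ennreal (dist (fst c) (snd c)) * emeasure \<pi> (T -` {fst c} \<times> T -` {snd c}))"
    using nn_integral_finite_valued[of "range T \<times> range T" \<pi> "\<lambda>p. (T (fst p), T (snd p))"
        "\<lambda>c. ennreal (dist (fst c) (snd c))"] F S unfolding eq by simp
  also have "\<dots> = (\<Sum>c\<in>range T \<times> range T. ennreal (q (fst c) (snd c) * dist (fst c) (snd c)))"
    by (intro sum.cong refl) (simp add: emeasure_eq_measure q_def ennreal_mult mult.commute)
  also have "\<dots> = ennreal (\<Sum>c\<in>range T \<times> range T. q (fst c) (snd c) * dist (fst c) (snd c))"
    by (intro sum_ennreal) (simp add: q_def)
  also have "(\<Sum>c\<in>range T \<times> range T. q (fst c) (snd c) * dist (fst c) (snd c)) =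
      (\<Sum>a\<in>range T. \<Sum>b\<in>range T. q a b * dist a b)"
    by (simp add: sum.cartesian_product case_prod_beta)
  finally show "(\<integral>\<^sup>+p. ennreal (dist (T (fst p)) (T (snd p))) \<partial>\<pi>) =
           ennreal (\<Sum>a\<in>range T. \<Sum>b\<in>range T. q a b * dist a b)" .
qed

text \<open>Given the cells of \<open>T\<close> containing the two coordinates, the lifted coupling makes the coordinates
  independent; this replaces the gluing lemma, which would need disintegration.\<close>
lemma coupling_lift:
  fixes T :: "'a::polish_space \<Rightarrow> 'a" and q :: "'a \<Rightarrow> 'a \<Rightarrow> real"
  assumes \<mu>: "borel_prob \<mu>" and \<nu>: "borel_prob \<nu>"
    and T[measurable]: "T \<in> borel_measurable borel" and F: "finite (range T)"
    and q0: "\<And>a b. a \<in> range T \<Longrightarrow> b \<in> range T \<Longrightarrow> 0 \<le> q a b"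
    and row: "\<And>a. a \<in> range T \<Longrightarrow> (\<Sum>b\<in>range T. q a b) = measure \<mu> (T -` {a})"
    and col: "\<And>b. b \<in> range T \<Longrightarrow> (\<Sum>a\<in>range T. q a b) = measure \<nu> (T -` {b})"
  shows "\<exists>\<pi>\<in>couplings \<mu> \<nu>. \<forall>a\<in>range T. \<forall>b\<in>range T. measure \<pi> (T -` {a} \<times> T -` {b}) = q a b"
proof -
  interpret \<mu>: prob_space \<mu> using borel_probD[OF \<mu>] by simp
  interpret \<nu>: prob_space \<nu> using borel_probD[OF \<nu>] by simp
  interpret pair_sigma_finite \<mu> \<nu> ..
  note sets\<mu>[measurable_cong] = borel_probD(2)[OF \<mu>] and sets\<nu>[measurable_cong] = borel_probD(2)[OF \<nu>]
  note spaces = borel_probD(3)[OF \<mu>] borel_probD(3)[OF \<nu>]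
  have Tm: "T -` {a} \<in> sets borel" for a using measurable_sets[OF T, of "{a}"] by simp
  define p1 where "p1 a = measure \<mu> (T -` {a})" for a
  define p2 where "p2 a = measure \<nu> (T -` {a})" for a
  \<comment> \<open>On each rectangle of cells \<open>g\<close> is the density of the lifted
    coupling with respect to the product measure. Where the denominator is 0 the quotient is 0 by
    convention; this agrees with \<open>q\<close>, whose entries are dominated by both marginals
    (\<open>q_zero\<close>).\<close>
  define g where "g a b = q a b / (p1 a * p2 b)" for a b
  have p0: "0 \<le> p1 a" "0 \<le> p2 a" for a by (auto simp: p1_def p2_def)
  have g0: "0 \<le> g a b" if "a \<in> range T" "b \<in> range T" for a b using that q0 p0 by (simp add: g_def)
  have q_zero: "q a b = 0" if "p1 a * p2 b = 0" "a \<in> range T" "b \<in> range T" for a b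
  proof -
    have "q a b \<le> p1 a"
      unfolding p1_def row[OF that(2), symmetric] using F that q0 by (intro member_le_sum) auto
    moreover have "q a b \<le> p2 b"
      unfolding p2_def col[OF that(3), symmetric] using F that q0
      by (intro member_le_sum[where f="\<lambda>a. q a b"]) auto
    ultimately show ?thesis using that q0[OF that(2,3)] by auto
  qed
  have g_mult: "g a b * (p1 a * p2 b) = q a b" if "a \<in> range T" "b \<in> range T" for a b
    using q_zero[OF _ that] by (auto simp: g_def)
  define f where "f p = ennreal (g (T (fst p)) (T (snd p)))" for p
  \<comment> \<open>Each point lies in exactly one rectangle, so the density is a finite combination
    of indicators. This yields its measurability.\<close>
  have f_eq: "f = (\<lambda>p. \<Sum>a\<in>range T. \<Sum>b\<in>range T. ennreal (g a b) * indicator (T -` {a} \<times> T -` {b}) p)"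
  proof
    fix p :: "'a \<times> 'a"
    have "(\<Sum>a\<in>range T. \<Sum>b\<in>range T. ennreal (g a b) * indicator (T -` {a} \<times> T -` {b}) p) =
      (\<Sum>a\<in>range T. \<Sum>b\<in>range T. if b = T (snd p) then (if a = T (fst p) then ennreal (g a b) else 0) else 0)"
      by (intro sum.cong refl) (cases p, simp add: indicator_def conj_commute eq_commute)
    also have "\<dots> = f p" by (simp only: sum.delta[OF F] rangeI if_True f_def)
    finally show "f p = (\<Sum>a\<in>range T. \<Sum>b\<in>range T. ennreal (g a b) * indicator (T -` {a} \<times> T -` {b}) p)" ..
  qed
  have [measurable]: "f \<in> borel_measurable (\<mu> \<Otimes>\<^sub>M \<nu>)"
    unfolding f_eq using Tm sets\<mu> sets\<nu>
    by (intro borel_measurable_sum borel_measurable_times borel_measurable_const borel_measurable_indicator) auto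
  \<comment> \<open>There are finitely many cells, so almost every point lies in a cell of positive
    mass. The normalisations \<open>inner1\<close> and \<open>inner2\<close> therefore hold almost
    everywhere.\<close>
  have null: "AE x in \<rho>. measure \<rho> (T -` {T x}) \<noteq> 0"
    if "prob_space \<rho>" "sets \<rho> = sets borel" "space \<rho> = UNIV" for \<rho> :: "'a measure"
  proof -
    interpret prob_space \<rho> by fact
    have "AE x in \<rho>. \<forall>a\<in>range T. measure \<rho> (T -` {a}) = 0 \<longrightarrow> x \<notin> T -` {a}"
    proof (intro AE_finite_allI F)
      fix a
      show "AE x in \<rho>. measure \<rho> (T -` {a}) = 0 \<longrightarrow> x \<notin> T -` {a}"
      proof (cases "measure \<rho> (T -` {a}) = 0")
        case True
        then have "T -` {a} \<in> null_sets \<rho>"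
          using Tm[of a] that by (simp add: null_sets_def emeasure_eq_measure)
        then show ?thesis by (auto dest: AE_not_in)
      qed simp
    qed
    then show ?thesis by eventually_elim auto
  qed
  define \<pi> where "\<pi> = density (\<mu> \<Otimes>\<^sub>M \<nu>) f"
  \<comment> \<open>Integrating out the second coordinate gives a row sum of \<open>q\<close>
    divided by the mass of that row. The first marginal of \<open>\<pi>\<close> thus has density 1
    with respect to \<open>\<mu>\<close>; \<open>inner2\<close> does the same with columns.\<close>
  have inner1: "(\<integral>\<^sup>+y. f (x, y) \<partial>\<nu>) = 1" if x: "p1 (T x) \<noteq> 0" for x
  proof -
    have "(\<integral>\<^sup>+y. f (x, y) \<partial>\<nu>) = (\<Sum>b\<in>range T. ennreal (g (T x) b) * emeasure \<nu> (T -` {b}))"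
      using nn_integral_finite_valued[of "range T" \<nu> T "\<lambda>b. ennreal (g (T x) b)"] F Tm sets\<nu> spaces
      by (simp add: f_def)
    also have "\<dots> = (\<Sum>b\<in>range T. ennreal (g (T x) b * p2 b))"
      by (intro sum.cong refl) (simp add: \<nu>.emeasure_eq_measure p2_def ennreal_mult g0)
    also have "\<dots> = ennreal (\<Sum>b\<in>range T. g (T x) b * p2 b)"
      by (intro sum_ennreal) (simp add: g0 p0)
    also have "(\<Sum>b\<in>range T. g (T x) b * p2 b) = (\<Sum>b\<in>range T. q (T x) b / p1 (T x))"
      by (intro sum.cong refl) (use x g_mult[of "T x"] in \<open>auto simp: field_simps\<close>)
    also have "\<dots> = 1" using x row[of "T x"] by (simp add: sum_divide_distrib[symmetric] p1_def)
    finally show ?thesis by simp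
  qed
  have inner2: "(\<integral>\<^sup>+x. f (x, y) \<partial>\<mu>) = 1" if y: "p2 (T y) \<noteq> 0" for y
  proof -
    have "(\<integral>\<^sup>+x. f (x, y) \<partial>\<mu>) = (\<Sum>a\<in>range T. ennreal (g a (T y)) * emeasure \<mu> (T -` {a}))"
      using nn_integral_finite_valued[of "range T" \<mu> T "\<lambda>a. ennreal (g a (T y))"] F Tm sets\<mu> spaces
      by (simp add: f_def)
    also have "\<dots> = (\<Sum>a\<in>range T. ennreal (g a (T y) * p1 a))"
      by (intro sum.cong refl) (simp add: \<mu>.emeasure_eq_measure p1_def ennreal_mult g0)
    also have "\<dots> = ennreal (\<Sum>a\<in>range T. g a (T y) * p1 a)"
      by (intro sum_ennreal) (simp add: g0 p0)
    also have "(\<Sum>a\<in>range T. g a (T y) * p1 a) = (\<Sum>a\<in>range T. q a (T y) / p2 (T y))"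
      by (intro sum.cong refl) (use y g_mult[of _ "T y"] in \<open>auto simp: field_simps\<close>)
    also have "\<dots> = 1" using y col[of "T y"] by (simp add: sum_divide_distrib[symmetric] p2_def)
    finally show ?thesis by simp
  qed
  have sets\<pi>: "sets \<pi> = sets (borel \<Otimes>\<^sub>M borel)"
    unfolding \<pi>_def sets_density by (intro sets_pair_measure_cong sets\<mu> sets\<nu>)
  have space\<pi>: "space \<pi> = UNIV" using sets_eq_imp_space_eq[OF sets\<pi>] by (simp add: space_pair_measure)
  note [measurable_cong] = sets\<pi>
  have marg1: "emeasure \<pi> (A \<times> UNIV) = emeasure \<mu> A" if [measurable]: "A \<in> sets borel" for A
  proof -
    have [simp]: "A \<in> sets \<mu>" using sets\<mu> by simp
    have AU: "A \<times> UNIV \<in> sets (\<mu> \<Otimes>\<^sub>M \<nu>)" using sets\<mu> sets\<nu> by auto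
    have "emeasure \<pi> (A \<times> UNIV) = (\<integral>\<^sup>+p. f p * indicator (A \<times> UNIV) p \<partial>(\<mu> \<Otimes>\<^sub>M \<nu>))"
      unfolding \<pi>_def using AU by (intro emeasure_density) auto
    also have "\<dots> = (\<integral>\<^sup>+x. \<integral>\<^sup>+y. f (x, y) * indicator (A \<times> UNIV) (x, y) \<partial>\<nu> \<partial>\<mu>)"
      using AU by (intro \<nu>.nn_integral_fst[symmetric]) measurable
    also have "\<dots> = (\<integral>\<^sup>+x. indicator A x \<partial>\<mu>)"
    proof (intro nn_integral_cong_AE)
      show "AE x in \<mu>. (\<integral>\<^sup>+y. f (x, y) * indicator (A \<times> UNIV) (x, y) \<partial>\<nu>) = indicator A x"
        using null[OF borel_probD[OF \<mu>]]
        by eventually_elim (use inner1 in \<open>auto simp: indicator_def p1_def\<close>)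
    qed
    finally show ?thesis by simp
  qed
  have marg2: "emeasure \<pi> (UNIV \<times> A) = emeasure \<nu> A" if [measurable]: "A \<in> sets borel" for A
  proof -
    have [simp]: "A \<in> sets \<nu>" using sets\<nu> by simp
    have AU: "UNIV \<times> A \<in> sets (\<mu> \<Otimes>\<^sub>M \<nu>)" using sets\<mu> sets\<nu> by auto
    have "emeasure \<pi> (UNIV \<times> A) = (\<integral>\<^sup>+p. f p * indicator (UNIV \<times> A) p \<partial>(\<mu> \<Otimes>\<^sub>M \<nu>))"
      unfolding \<pi>_def using AU by (intro emeasure_density) auto
    also have "\<dots> = (\<integral>\<^sup>+y. \<integral>\<^sup>+x. f (x, y) * indicator (UNIV \<times> A) (x, y) \<partial>\<mu> \<partial>\<nu>)"
      using AU by (intro nn_integral_snd[symmetric]) measurable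
    also have "\<dots> = (\<integral>\<^sup>+x. indicator A x \<partial>\<nu>)"
    proof (intro nn_integral_cong_AE)
      show "AE y in \<nu>. (\<integral>\<^sup>+x. f (x, y) * indicator (UNIV \<times> A) (x, y) \<partial>\<mu>) = indicator A y"
        using null[OF borel_probD[OF \<nu>]]
        by eventually_elim (use inner2 in \<open>auto simp: indicator_def p2_def\<close>)
    qed
    finally show ?thesis by simp
  qed
  have "\<pi> \<in> couplings \<mu> \<nu>"
    unfolding couplings_def
  proof (intro CollectI conjI)
    have "emeasure \<pi> (UNIV \<times> UNIV) = 1"
      using marg1[of UNIV] \<mu>.emeasure_space_1 spaces by simp
    then show "prob_space \<pi>" by (intro prob_spaceI) (simp add: space\<pi>)
    show "sets \<pi> = sets borel" unfolding sets\<pi> borel_prod ..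
    show "distr \<pi> borel fst = \<mu>"
    proof (rule measure_eqI)
      fix A assume "A \<in> sets (distr \<pi> borel fst)"
      then have A: "A \<in> sets borel" by simp
      have "emeasure (distr \<pi> borel fst) A = emeasure \<pi> (A \<times> UNIV)"
        using A by (subst emeasure_distr) (auto simp: space\<pi> intro!: arg_cong[where f="emeasure \<pi>"])
      then show "emeasure (distr \<pi> borel fst) A = emeasure \<mu> A" using marg1[OF A] by simp
    qed (simp add: sets\<mu>)
    show "distr \<pi> borel snd = \<nu>"
    proof (rule measure_eqI)
      fix A assume "A \<in> sets (distr \<pi> borel snd)"
      then have A: "A \<in> sets borel" by simp
      have "emeasure (distr \<pi> borel snd) A = emeasure \<pi> (UNIV \<times> A)"
        using A by (subst emeasure_distr) (auto simp: space\<pi> intro!: arg_cong[where f="emeasure \<pi>"])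
      then show "emeasure (distr \<pi> borel snd) A = emeasure \<nu> A" using marg2[OF A] by simp
    qed (simp add: sets\<nu>)
  qed
  moreover have "measure \<pi> (T -` {a} \<times> T -` {b}) = q a b" if ab: "a \<in> range T" "b \<in> range T" for a b
  proof -
    have Ta: "T -` {a} \<in> sets \<mu>" and Tb: "T -` {b} \<in> sets \<nu>" using Tm sets\<mu> sets\<nu> by auto
    have "emeasure \<pi> (T -` {a} \<times> T -` {b}) = (\<integral>\<^sup>+p. f p * indicator (T -` {a} \<times> T -` {b}) p \<partial>(\<mu> \<Otimes>\<^sub>M \<nu>))"
      unfolding \<pi>_def using Ta Tb by (intro emeasure_density) auto
    also have "\<dots> = (\<integral>\<^sup>+p. ennreal (g a b) * indicator (T -` {a} \<times> T -` {b}) p \<partial>(\<mu> \<Otimes>\<^sub>M \<nu>))"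
      by (intro nn_integral_cong) (auto simp: f_def indicator_def)
    also have "\<dots> = ennreal (g a b) * (emeasure \<mu> (T -` {a}) * emeasure \<nu> (T -` {b}))"
      using Ta Tb by (subst nn_integral_cmult_indicator) (auto simp: \<nu>.emeasure_pair_measure_Times)
    also have "\<dots> = ennreal (g a b * (p1 a * p2 b))"
      using g0[OF ab] by (simp add: \<mu>.emeasure_eq_measure \<nu>.emeasure_eq_measure p1_def p2_def ennreal_mult)
    finally show ?thesis using g_mult[OF ab] q0[OF ab] by (simp add: measure_def)
  qed
  ultimately show ?thesis by blast
qed

text \<open>The triangle inequality is integrated against \<open>\<pi>\<close>. Each error term
  depends on one coordinate only, so its integral is determined by a marginal and is the same for
  all couplings.\<close>

lemma coupling_cost_quantize:
  fixes T :: "'a::polish_space \<Rightarrow> 'a"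
  assumes pi: "\<pi> \<in> couplings \<mu> \<nu>" and T[measurable]: "T \<in> borel_measurable borel"
  defines "E \<equiv> \<lambda>\<rho>. \<integral>\<^sup>+x. ennreal (dist x (T x)) \<partial>\<rho>"
  shows "(\<integral>\<^sup>+p. ennreal (dist (T (fst p)) (T (snd p))) \<partial>\<pi>) \<le>
          (\<integral>\<^sup>+p. ennreal (dist (fst p) (snd p)) \<partial>\<pi>) + (E \<mu> + E \<nu>)"
    and "(\<integral>\<^sup>+p. ennreal (dist (fst p) (snd p)) \<partial>\<pi>) \<le>
          (\<integral>\<^sup>+p. ennreal (dist (T (fst p)) (T (snd p))) \<partial>\<pi>) + (E \<mu> + E \<nu>)"
proof -
  have \<pi>: "sets \<pi> = sets (borel \<Otimes>\<^sub>M borel)" "distr \<pi> borel fst = \<mu>" "distr \<pi> borel snd = \<nu>"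
    using pi unfolding couplings_def borel_prod by simp_all
  note [measurable_cong] = \<pi>(1)
  have E1: "E \<mu> = (\<integral>\<^sup>+p. ennreal (dist (fst p) (T (fst p))) \<partial>\<pi>)"
    unfolding \<pi>(2)[symmetric] E_def by (subst nn_integral_distr) auto
  have E2: "E \<nu> = (\<integral>\<^sup>+p. ennreal (dist (snd p) (T (snd p))) \<partial>\<pi>)"
    unfolding \<pi>(3)[symmetric] E_def by (subst nn_integral_distr) auto
  have tri: "dist (T x) (T y) \<le> dist x y + (dist x (T x) + dist y (T y))"
    "dist x y \<le> dist (T x) (T y) + (dist x (T x) + dist y (T y))" for x y
    by metric+
  show "(\<integral>\<^sup>+p. ennreal (dist (T (fst p)) (T (snd p))) \<partial>\<pi>) \<le>
          (\<integral>\<^sup>+p. ennreal (dist (fst p) (snd p)) \<partial>\<pi>) + (E \<mu> + E \<nu>)"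
    unfolding E1 E2 using tri(1)
    by (subst nn_integral_add[symmetric]; (measurable | simp)?)+
       (intro nn_integral_mono, simp flip: ennreal_plus)
  show "(\<integral>\<^sup>+p. ennreal (dist (fst p) (snd p)) \<partial>\<pi>) \<le>
          (\<integral>\<^sup>+p. ennreal (dist (T (fst p)) (T (snd p))) \<partial>\<pi>) + (E \<mu> + E \<nu>)"
    unfolding E1 E2 using tri(2)
    by (subst nn_integral_add[symmetric]; (measurable | simp)?)+
       (intro nn_integral_mono, simp flip: ennreal_plus)
qed

text \<open>Every coupling of the old pair is quantized to a matrix, adjusted to the new cell
  probabilities, lifted, and compared with its own quantized cost. The total loss \<open>c\<close>
  does not depend on the coupling, so the infimum can be taken without an optimal plan.\<close>

lemma W1_perturb:
  fixes T :: "'a::polish_space \<Rightarrow> 'a"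
  assumes bp: "borel_prob \<mu>" "borel_prob \<nu>" "borel_prob \<mu>'" "borel_prob \<nu>'"
    and T[measurable]: "T \<in> borel_measurable borel" and F: "finite (range T)"
    and int: "integrable \<mu> (\<lambda>x. dist x (T x))" "integrable \<nu> (\<lambda>x. dist x (T x))"
      "integrable \<mu>' (\<lambda>x. dist x (T x))" "integrable \<nu>' (\<lambda>x. dist x (T x))"
    and D: "\<And>x y. dist (T x) (T y) \<le> D"
  shows "W1 \<mu>' \<nu>' \<le> W1 \<mu> \<nu> + ((\<integral>x. dist x (T x) \<partial>\<mu>) + (\<integral>x. dist x (T x) \<partial>\<nu>)
      + (\<integral>x. dist x (T x) \<partial>\<mu>') + (\<integral>x. dist x (T x) \<partial>\<nu>'))
      + D * ((\<Sum>a\<in>range T. \<bar>measure \<mu> (T -` {a}) - measure \<mu>' (T -` {a})\<bar>)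
           + (\<Sum>a\<in>range T. \<bar>measure \<nu> (T -` {a}) - measure \<nu>' (T -` {a})\<bar>))"
proof -
  define e where "e \<rho> = (\<integral>x. dist x (T x) \<partial>\<rho>)" for \<rho>
  define cost where "cost \<pi> = (\<integral>\<^sup>+p. ennreal (dist (fst p) (snd p)) \<partial>\<pi>)" for \<pi> :: "('a \<times> 'a) measure"
  define costT where "costT \<pi> = (\<integral>\<^sup>+p. ennreal (dist (T (fst p)) (T (snd p))) \<partial>\<pi>)" for \<pi> :: "('a \<times> 'a) measure"
  define S where "S = (\<Sum>a\<in>range T. \<bar>measure \<mu> (T -` {a}) - measure \<mu>' (T -` {a})\<bar>)
           + (\<Sum>a\<in>range T. \<bar>measure \<nu> (T -` {a}) - measure \<nu>' (T -` {a})\<bar>)"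
  have e0: "0 \<le> e \<rho>" for \<rho> by (simp add: e_def)
  have S0: "0 \<le> S" by (auto simp: S_def intro!: add_nonneg_nonneg sum_nonneg)
  have D0: "0 \<le> D" using D[of undefined undefined] by simp
  have E: "(\<integral>\<^sup>+x. ennreal (dist x (T x)) \<partial>\<rho>) = ennreal (e \<rho>)" if "integrable \<rho> (\<lambda>x. dist x (T x))" for \<rho>
    using that unfolding e_def by (intro nn_integral_eq_integral) auto
  have cT: "costT \<pi> \<le> cost \<pi> + ennreal (e \<mu> + e \<nu>)" if "\<pi> \<in> couplings \<mu> \<nu>" for \<pi>
    using coupling_cost_quantize(1)[OF that T] int E e0 unfolding cost_def costT_def by simp
  have Tc: "cost \<pi> \<le> costT \<pi> + ennreal (e \<rho> + e \<rho>')"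
    if "\<pi> \<in> couplings \<rho> \<rho>'" "integrable \<rho> (\<lambda>x. dist x (T x))" "integrable \<rho>' (\<lambda>x. dist x (T x))" for \<pi> \<rho> \<rho>'
    using coupling_cost_quantize(2)[OF that(1) T] that E e0 unfolding cost_def costT_def by simp
  note quant = coupling_quantize[OF _ T F]
  define c where "c = e \<mu> + e \<nu> + e \<mu>' + e \<nu>' + D * S"
  have c0: "0 \<le> c" unfolding c_def by (intro add_nonneg_nonneg mult_nonneg_nonneg e0 D0 S0)
  have step: "\<exists>\<pi>'\<in>couplings \<mu>' \<nu>'. cost \<pi>' \<le> ennreal c + cost \<pi>" if \<pi>: "\<pi> \<in> couplings \<mu> \<nu>" for \<pi>
  proof -
    define q where "q a b = measure \<pi> (T -` {a} \<times> T -` {b})" for a b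
    obtain q' where q': "\<And>a b. a \<in> range T \<Longrightarrow> b \<in> range T \<Longrightarrow> 0 \<le> q' a b"
      "\<And>a. a \<in> range T \<Longrightarrow> (\<Sum>b\<in>range T. q' a b) = measure \<mu>' (T -` {a})"
      "\<And>b. b \<in> range T \<Longrightarrow> (\<Sum>a\<in>range T. q' a b) = measure \<nu>' (T -` {b})"
      "(\<Sum>a\<in>range T. \<Sum>b\<in>range T. q' a b * dist a b) \<le>
         (\<Sum>a\<in>range T. \<Sum>b\<in>range T. q a b * dist a b) + D * S"
    proof -
      have "\<exists>q'. (\<forall>a b. a \<in> range T \<longrightarrow> b \<in> range T \<longrightarrow> 0 \<le> q' a b) \<and>
        (\<forall>a\<in>range T. (\<Sum>b\<in>range T. q' a b) = measure \<mu>' (T -` {a})) \<and>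
        (\<forall>b\<in>range T. (\<Sum>a\<in>range T. q' a b) = measure \<nu>' (T -` {b})) \<and>
        (\<Sum>a\<in>range T. \<Sum>b\<in>range T. q' a b * dist a b) \<le>
          (\<Sum>a\<in>range T. \<Sum>b\<in>range T. q a b * dist a b) + D * S"
        unfolding S_def
      proof (rule finite_transport_perturb[OF F])
        show "dist a b \<le> D" if "a \<in> range T" "b \<in> range T" for a b using that D by auto
      qed (use quant(1,2)[OF \<pi>] sum_measure_fibres[OF bp(1) T F] sum_measure_fibres[OF bp(3) T F]
            sum_measure_fibres[OF bp(4) T F] in \<open>simp_all add: q_def\<close>)
      then show ?thesis using that by blast
    qed
    obtain \<pi>' where \<pi>': "\<pi>' \<in> couplings \<mu>' \<nu>'"
      "\<And>a b. a \<in> range T \<Longrightarrow> b \<in> range T \<Longrightarrow> measure \<pi>' (T -` {a} \<times> T -` {b}) = q' a b"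
      using coupling_lift[OF bp(3,4) T F q'(1-3)] by blast
    have "costT \<pi>' = ennreal (\<Sum>a\<in>range T. \<Sum>b\<in>range T. q' a b * dist a b)"
      unfolding costT_def quant(3)[OF \<pi>'(1)]
      by (intro arg_cong[where f=ennreal] sum.cong refl) (simp add: \<pi>'(2))
    also have "\<dots> \<le> ennreal ((\<Sum>a\<in>range T. \<Sum>b\<in>range T. q a b * dist a b) + D * S)"
      using q'(4) by (rule ennreal_leI)
    also have "\<dots> = costT \<pi> + ennreal (D * S)"
      unfolding costT_def quant(3)[OF \<pi>] q_def using D0 S0
      by (intro ennreal_plus sum_nonneg) auto
    also have "\<dots> \<le> cost \<pi> + ennreal (e \<mu> + e \<nu>) + ennreal (D * S)"
      by (intro add_right_mono cT \<pi>)
    finally have "cost \<pi>' \<le> cost \<pi> + ennreal (e \<mu> + e \<nu>) + ennreal (D * S) + ennreal (e \<mu>' + e \<nu>')"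
      using Tc[OF \<pi>'(1) int(3,4)] by (meson add_right_mono order_trans)
    also have "\<dots> = ennreal c + cost \<pi>"
      using e0 D0 S0 by (simp add: c_def add_ac)
    finally show ?thesis using \<pi>'(1) by blast
  qed
  \<comment> \<open>Subtracting \<open>c\<close> on the left leaves a lower bound of every single
    cost, which is what \<open>INF_greatest\<close> asks for; \<open>c\<close> is moved back
    afterwards.\<close>
  have "(INF \<pi>\<in>couplings \<mu>' \<nu>'. cost \<pi>) - ennreal c \<le> (INF \<pi>\<in>couplings \<mu> \<nu>. cost \<pi>)"
  proof (rule INF_greatest)
    fix \<pi> assume "\<pi> \<in> couplings \<mu> \<nu>"
    from step[OF this] obtain \<pi>' where "\<pi>' \<in> couplings \<mu>' \<nu>'" "cost \<pi>' \<le> ennreal c + cost \<pi>" by blast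
    then have "(INF \<pi>\<in>couplings \<mu>' \<nu>'. cost \<pi>) \<le> ennreal c + cost \<pi>" by (meson INF_lower2)
    then show "(INF \<pi>\<in>couplings \<mu>' \<nu>'. cost \<pi>) - ennreal c \<le> cost \<pi>"
      by (simp add: ennreal_minus_le_iff)
  qed
  then have le: "(INF \<pi>\<in>couplings \<mu>' \<nu>'. cost \<pi>) \<le> ennreal c + (INF \<pi>\<in>couplings \<mu> \<nu>. cost \<pi>)"
    by (simp add: ennreal_minus_le_iff)
  \<comment> \<open>Finiteness matters because \<open>enn2real\<close> sends infinity to 0, which
    would break the passage to real numbers. The product matrix has the right row and column sums,
    and its lift is a coupling of finite cost.\<close>
  have fin: "(INF \<pi>\<in>couplings \<mu> \<nu>. cost \<pi>) < \<infinity>"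
  proof -
    have "\<exists>\<pi>\<in>couplings \<mu> \<nu>. \<forall>a\<in>range T. \<forall>b\<in>range T.
        measure \<pi> (T -` {a} \<times> T -` {b}) = measure \<mu> (T -` {a}) * measure \<nu> (T -` {b})"
      using sum_measure_fibres[OF bp(1) T F] sum_measure_fibres[OF bp(2) T F]
      by (intro coupling_lift bp T F) (simp_all flip: sum_distrib_left sum_distrib_right)
    then obtain \<pi> where \<pi>: "\<pi> \<in> couplings \<mu> \<nu>" by blast
    have "cost \<pi> \<le> costT \<pi> + ennreal (e \<mu> + e \<nu>)" using Tc[OF \<pi> int(1,2)] .
    also have "\<dots> < \<infinity>" unfolding costT_def quant(3)[OF \<pi>] by (simp add: ennreal_add_less_top)
    finally show ?thesis using \<pi> by (meson INF_lower order.strict_trans1)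
  qed
  have "W1 \<mu>' \<nu>' \<le> enn2real (ennreal c + (INF \<pi>\<in>couplings \<mu> \<nu>. cost \<pi>))"
    unfolding W1_def cost_def[symmetric] using le fin
    by (intro enn2real_mono) (auto simp: ennreal_add_less_top)
  also have "\<dots> = c + W1 \<mu> \<nu>"
    unfolding W1_def cost_def[symmetric] using fin c0 by (subst enn2real_plus) auto
  finally show ?thesis unfolding c_def e_def S_def by simp
qed

subsection \<open>Mixtures\<close>

lemma sets_mixture [simp]: "sets (mixture I w P) = sets borel"
  unfolding mixture_def using sets.sigma_sets_eq[of borel] sets.space_closed[of borel]
  by (subst sets_measure_of) auto

text \<open>\<open>measure_of\<close> returns the prescribed set function only once it is known to
  be countably additive; this holds because a finite sum commutes with a series in
  \<open>ennreal\<close>.\<close>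

lemma emeasure_mixture:
  fixes P :: "'i \<Rightarrow> 'a::metric_space measure"
  assumes "finite I" and s: "\<And>i. i \<in> I \<Longrightarrow> sets (P i) = sets borel" and A: "A \<in> sets borel"
  shows "emeasure (mixture I w P) A = (\<Sum>i\<in>I. ennreal (w i) * emeasure (P i) A)"
  unfolding mixture_def
proof (rule emeasure_measure_of_sigma)
  show "sigma_algebra UNIV (sets borel)" using sets.sigma_algebra_axioms[of borel] by simp
  show "positive (sets borel) (\<lambda>A. \<Sum>i\<in>I. ennreal (w i) * emeasure (P i) A)"
    by (simp add: positive_def)
  show "countably_additive (sets borel) (\<lambda>A. \<Sum>i\<in>I. ennreal (w i) * emeasure (P i) A)"
  proof (rule countably_additiveI)
    fix B :: "nat \<Rightarrow> 'a set" assume B: "range B \<subseteq> sets borel" "disjoint_family B"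
    have "(\<Sum>n. \<Sum>i\<in>I. ennreal (w i) * emeasure (P i) (B n)) = (\<Sum>i\<in>I. \<Sum>n. ennreal (w i) * emeasure (P i) (B n))"
      by (intro suminf_sum) auto
    also have "\<dots> = (\<Sum>i\<in>I. ennreal (w i) * emeasure (P i) (\<Union>n. B n))"
      using B s by (intro sum.cong refl) (simp add: suminf_emeasure)
    finally show "(\<Sum>n. \<Sum>i\<in>I. ennreal (w i) * emeasure (P i) (B n)) =
        (\<Sum>i\<in>I. ennreal (w i) * emeasure (P i) (\<Union>n. B n))" .
  qed
qed fact

lemma measure_mixture:
  assumes "finite I" and P: "\<And>i. i \<in> I \<Longrightarrow> borel_prob (P i)" and w: "\<And>i. i \<in> I \<Longrightarrow> 0 \<le> w i"
    and A: "A \<in> sets borel"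
  shows "measure (mixture I w P) A = (\<Sum>i\<in>I. w i * measure (P i) A)"
proof -
  have "emeasure (mixture I w P) A = (\<Sum>i\<in>I. ennreal (w i) * emeasure (P i) A)"
    using assms borel_probD(2) by (intro emeasure_mixture) auto
  also have "\<dots> = (\<Sum>i\<in>I. ennreal (w i * measure (P i) A))"
  proof (intro sum.cong refl)
    fix i assume "i \<in> I"
    interpret prob_space "P i" using borel_probD[OF P[OF \<open>i \<in> I\<close>]] by simp
    show "ennreal (w i) * emeasure (P i) A = ennreal (w i * measure (P i) A)"
      using w[OF \<open>i \<in> I\<close>] by (simp add: emeasure_eq_measure ennreal_mult)
  qed
  also have "\<dots> = ennreal (\<Sum>i\<in>I. w i * measure (P i) A)"
    using w by (intro sum_ennreal) auto
  finally show ?thesis using w by (simp add: measure_def sum_nonneg)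
qed

lemma borel_prob_mixture:
  assumes "finite I" and P: "\<And>i. i \<in> I \<Longrightarrow> borel_prob (P i)" and w: "\<And>i. i \<in> I \<Longrightarrow> 0 \<le> w i"
    and w1: "(\<Sum>i\<in>I. w i) = 1"
  shows "borel_prob (mixture I w P)"
  unfolding borel_prob_def
proof
  have sp: "space (mixture I w P) = UNIV" using sets_eq_imp_space_eq[OF sets_mixture] by simp
  have "emeasure (mixture I w P) UNIV = (\<Sum>i\<in>I. ennreal (w i) * emeasure (P i) UNIV)"
    using assms borel_probD(2) by (intro emeasure_mixture) auto
  also have "\<dots> = (\<Sum>i\<in>I. ennreal (w i))"
  proof (intro sum.cong refl)
    fix i assume "i \<in> I"
    then show "ennreal (w i) * emeasure (P i) UNIV = ennreal (w i)"
      using prob_space.emeasure_space_1[OF borel_probD(1)[OF P]] borel_probD(3)[OF P] by simp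
  qed
  also have "\<dots> = 1" using w w1 by (simp add: sum_ennreal)
  finally show "prob_space (mixture I w P)" by (intro prob_spaceI) (simp add: sp)
qed simp

text \<open>Induction over nonnegative Borel functions, starting from indicators. In the limit step
  the integrals are increasing in \<open>n\<close> for each component, so the supremum commutes with
  the finite weighted sum.\<close>

lemma nn_integral_mixture:
  assumes "finite I" and s: "\<And>i. i \<in> I \<Longrightarrow> sets (P i) = sets borel"
    and f: "f \<in> borel_measurable borel"
  shows "integral\<^sup>N (mixture I w P) f = (\<Sum>i\<in>I. ennreal (w i) * integral\<^sup>N (P i) f)"
  using f
proof (induct f)
  case (cong f g)
  then have "f = g" by auto
  then show ?case using cong by simp
next
  case (set A)
  then show ?case using s by (simp add: emeasure_mixture[OF assms(1) s])
next
  case (mult u c)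
  have [measurable]: "u \<in> borel_measurable (P i)" if "i \<in> I" for i
    using mult s[OF that] by (simp cong: measurable_cong_sets)
  have [measurable]: "u \<in> borel_measurable (mixture I w P)"
    using mult by (simp cong: measurable_cong_sets)
  show ?case using mult(4) by (simp add: nn_integral_cmult sum_distrib_left mult_ac)
next
  case (add u v)
  have [measurable]: "u \<in> borel_measurable (P i)" "v \<in> borel_measurable (P i)" if "i \<in> I" for i
    using add s[OF that] by (simp_all cong: measurable_cong_sets)
  have [measurable]: "u \<in> borel_measurable (mixture I w P)" "v \<in> borel_measurable (mixture I w P)"
    using add by (simp_all cong: measurable_cong_sets)
  show ?case using add(3,7) by (simp add: nn_integral_add sum.distrib distrib_left)
next
  case (seq U)
  have m: "U n \<in> borel_measurable (P i)" if "i \<in> I" for i n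
    using seq s[OF that] by (simp cong: measurable_cong_sets)
  have m': "U n \<in> borel_measurable (mixture I w P)" for n
    using seq by (simp cong: measurable_cong_sets)
  have inc: "incseq (\<lambda>n. integral\<^sup>N M (U n))" for M
    using seq(4) by (auto simp: incseq_def le_fun_def intro!: nn_integral_mono)
  have conv: "integral\<^sup>N M (SUP n. U n) = (SUP n. integral\<^sup>N M (U n))"
    if "\<And>n. U n \<in> borel_measurable M" for M
    using nn_integral_monotone_convergence_SUP[OF seq(4) that]
    by (simp add: SUP_apply[abs_def])
  have "integral\<^sup>N (mixture I w P) (SUP n. U n) = (SUP n. \<Sum>i\<in>I. ennreal (w i) * integral\<^sup>N (P i) (U n))"
    using conv[OF m'] seq(3) by simp
  also have "\<dots> = (\<Sum>i\<in>I. SUP n. ennreal (w i) * integral\<^sup>N (P i) (U n))"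
    using inc by (intro ennreal_SUP_sum) (auto simp: incseq_def intro!: mult_left_mono)
  also have "\<dots> = (\<Sum>i\<in>I. ennreal (w i) * integral\<^sup>N (P i) (SUP n. U n))"
    by (intro sum.cong refl) (simp add: conv[OF m] SUP_mult_left_ennreal)
  finally show ?case .
qed

lemma integral_mixture:
  assumes "finite I" and P: "\<And>i. i \<in> I \<Longrightarrow> borel_prob (P i)" and w: "\<And>i. i \<in> I \<Longrightarrow> 0 \<le> w i"
    and f[measurable]: "f \<in> borel_measurable borel" and f0: "\<And>x. 0 \<le> (f x :: real)"
    and int: "\<And>i. i \<in> I \<Longrightarrow> integrable (P i) f"
  shows "integrable (mixture I w P) f"
    and "(\<integral>x. f x \<partial>mixture I w P) = (\<Sum>i\<in>I. w i * (\<integral>x. f x \<partial>P i))"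
proof -
  have m: "f \<in> borel_measurable (mixture I w P)" by (simp cong: measurable_cong_sets)
  have i0: "0 \<le> (\<integral>x. f x \<partial>P i)" for i using f0 by simp
  have "(\<integral>\<^sup>+x. ennreal (f x) \<partial>mixture I w P) = (\<Sum>i\<in>I. ennreal (w i) * (\<integral>\<^sup>+x. ennreal (f x) \<partial>P i))"
    using assms(1) borel_probD(2)[OF P] by (intro nn_integral_mixture) auto
  also have "\<dots> = (\<Sum>i\<in>I. ennreal (w i * (\<integral>x. f x \<partial>P i)))"
    using int f0 w i0 by (intro sum.cong refl) (simp add: nn_integral_eq_integral ennreal_mult)
  also have "\<dots> = ennreal (\<Sum>i\<in>I. w i * (\<integral>x. f x \<partial>P i))"
    using w i0 by (intro sum_ennreal) auto
  finally have eq: "(\<integral>\<^sup>+x. ennreal (f x) \<partial>mixture I w P) = ennreal (\<Sum>i\<in>I. w i * (\<integral>x. f x \<partial>P i))" .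
  show "integrable (mixture I w P) f"
    using m f0 eq by (intro integrableI_nonneg) auto
  show "(\<integral>x. f x \<partial>mixture I w P) = (\<Sum>i\<in>I. w i * (\<integral>x. f x \<partial>P i))"
  proof -
    have "0 \<le> (\<Sum>i\<in>I. w i * (\<integral>x. f x \<partial>P i))" by (intro sum_nonneg mult_nonneg_nonneg w i0)
    moreover have "(\<integral>x. f x \<partial>mixture I w P) = enn2real (\<integral>\<^sup>+x. ennreal (f x) \<partial>mixture I w P)"
      using m f0 by (intro integral_eq_nn_integral) auto
    ultimately show ?thesis unfolding eq by simp
  qed
qed

text \<open>Weights are at most 1, so all errors of a mixture are dominated by unweighted sums over
  its components, uniformly in the weights. With \<open>l = l'\<close> this compares two families of
  measures; with \<open>P = P'\<close> it gives continuity in the weights.\<close>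

lemma W1_mixture_perturb:
  fixes T :: "'a::polish_space \<Rightarrow> 'a"
  assumes P: "\<And>j. j \<in> {1..J+1} \<Longrightarrow> borel_prob (P j)" and P': "\<And>j. j \<in> {1..J+1} \<Longrightarrow> borel_prob (P' j)"
    and T[measurable]: "T \<in> borel_measurable borel" and F: "finite (range T)"
    and int: "\<And>j. j \<in> {1..J+1} \<Longrightarrow> integrable (P j) (\<lambda>x. dist x (T x))"
      "\<And>j. j \<in> {1..J+1} \<Longrightarrow> integrable (P' j) (\<lambda>x. dist x (T x))"
    and D: "\<And>x y. dist (T x) (T y) \<le> D"
    and l: "l \<in> Simplex J" "l' \<in> Simplex J"
  shows "W1 (mixture {2..J+1} l' P') (P' 1) \<le> W1 (mixture {2..J+1} l P) (P 1)
     + (\<Sum>j=1..J+1. (\<integral>x. dist x (T x) \<partial>P j) + (\<integral>x. dist x (T x) \<partial>P' j)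
         + D * (\<Sum>a\<in>range T. \<bar>measure (P j) (T -` {a}) - measure (P' j) (T -` {a})\<bar>))
     + D * (\<Sum>j=2..J+1. \<bar>l j - l' j\<bar>)"
proof -
  let ?I = "{2..J+1}"
  define e where "e \<rho> = (\<integral>x. dist x (T x) \<partial>\<rho>)" for \<rho>
  define V where "V \<rho> \<rho>' = (\<Sum>a\<in>range T. \<bar>measure \<rho> (T -` {a}) - measure \<rho>' (T -` {a})\<bar>)" for \<rho> \<rho>'
  have e0: "0 \<le> e \<rho>" for \<rho> by (simp add: e_def)
  have V0: "0 \<le> V \<rho> \<rho>'" for \<rho> \<rho>' by (auto simp: V_def intro!: sum_nonneg)
  have D0: "0 \<le> D" using D[of undefined undefined] by simp
  have l0: "0 \<le> l j" "0 \<le> l' j" if "j \<in> ?I" for j using l that by (auto simp: Simplex_def)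
  have l1: "(\<Sum>j\<in>?I. l j) = 1" "(\<Sum>j\<in>?I. l' j) = 1" using l by (auto simp: Simplex_def)
  have lle1: "m j \<le> 1" if "m \<in> Simplex J" "j \<in> ?I" for m j
    using that member_le_sum[of j ?I m] by (auto simp: Simplex_def)
  have sub: "j \<in> {1..J+1}" if "j \<in> ?I" for j using that by auto
  have PI: "borel_prob (P j)" "borel_prob (P' j)" "integrable (P j) (\<lambda>x. dist x (T x))"
    "integrable (P' j) (\<lambda>x. dist x (T x))" if "j \<in> ?I" for j
    using P P' int sub[OF that] by auto
  have Tm: "T -` {a} \<in> sets borel" for a using measurable_sets[OF T, of "{a}"] by simp
  note fI = finite_atLeastAtMost[of 2 "J+1"]
  have emix: "e (mixture ?I m R) \<le> (\<Sum>j\<in>?I. e (R j))"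
    if "m \<in> Simplex J" "\<And>j. j \<in> ?I \<Longrightarrow> borel_prob (R j)"
      "\<And>j. j \<in> ?I \<Longrightarrow> integrable (R j) (\<lambda>x. dist x (T x))" for m R
  proof -
    have m0: "0 \<le> m j" if "j \<in> ?I" for j using \<open>m \<in> Simplex J\<close> that by (auto simp: Simplex_def)
    have "e (mixture ?I m R) = (\<Sum>j\<in>?I. m j * e (R j))"
      unfolding e_def using that m0 by (intro integral_mixture fI) auto
    also have "\<dots> \<le> (\<Sum>j\<in>?I. e (R j))"
      using lle1[OF that(1)] m0 e0 by (intro sum_mono mult_left_le_one_le) auto
    finally show ?thesis .
  qed
  have mm: "measure (mixture ?I l P) (T -` {a}) = (\<Sum>j\<in>?I. l j * measure (P j) (T -` {a}))"
    "measure (mixture ?I l' P') (T -` {a}) = (\<Sum>j\<in>?I. l' j * measure (P' j) (T -` {a}))" for a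
    by (intro measure_mixture fI PI l0 Tm; assumption)+
  have Vmix: "V (mixture ?I l P) (mixture ?I l' P') \<le> (\<Sum>j\<in>?I. V (P j) (P' j)) + (\<Sum>j\<in>?I. \<bar>l j - l' j\<bar>)"
  proof -
    have "V (mixture ?I l P) (mixture ?I l' P') =
      (\<Sum>a\<in>range T. \<bar>\<Sum>j\<in>?I. l j * measure (P j) (T -` {a}) - l' j * measure (P' j) (T -` {a})\<bar>)"
      unfolding V_def mm sum_subtractf ..
    also have "\<dots> \<le> (\<Sum>a\<in>range T. \<Sum>j\<in>?I. \<bar>measure (P j) (T -` {a}) - measure (P' j) (T -` {a})\<bar>
        + \<bar>l j - l' j\<bar> * measure (P' j) (T -` {a}))"
    proof (intro sum_mono order_trans[OF sum_abs])
      fix a j assume j: "j \<in> ?I"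
      let ?p = "measure (P j) (T -` {a})" and ?p' = "measure (P' j) (T -` {a})"
      \<comment> \<open>The change of a weighted cell probability splits into a change of the
        measure and a change of the weight.\<close>
      have "\<bar>l j * ?p - l' j * ?p'\<bar> = \<bar>l j * (?p - ?p') + (l j - l' j) * ?p'\<bar>" by (simp add: algebra_simps)
      also have "\<dots> \<le> l j * \<bar>?p - ?p'\<bar> + \<bar>l j - l' j\<bar> * ?p'"
        using l0[OF j] by (metis abs_triangle_ineq abs_mult abs_of_nonneg measure_nonneg)
      also have "\<dots> \<le> \<bar>?p - ?p'\<bar> + \<bar>l j - l' j\<bar> * ?p'"
        using l0[OF j] lle1[OF l(1) j] by (simp add: mult_left_le_one_le)
      finally show "\<bar>l j * ?p - l' j * ?p'\<bar> \<le> \<bar>?p - ?p'\<bar> + \<bar>l j - l' j\<bar> * ?p'" .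
    qed
    \<comment> \<open>After exchanging the sums, the cell probabilities of each \<open>P' j\<close>
      add up to 1 and only the \<open>l1\<close> distance of the weights remains.\<close>
    also have "\<dots> = (\<Sum>j\<in>?I. V (P j) (P' j) + \<bar>l j - l' j\<bar> * (\<Sum>a\<in>range T. measure (P' j) (T -` {a})))"
      by (subst sum.swap) (simp add: V_def sum.distrib sum_distrib_left)
    also have "\<dots> = (\<Sum>j\<in>?I. V (P j) (P' j)) + (\<Sum>j\<in>?I. \<bar>l j - l' j\<bar>)"
      unfolding sum.distrib using sum_measure_fibres[OF PI(2) T F] by simp
    finally show ?thesis .
  qed
  have split1: "(\<Sum>j=1..J+1. h j) = h 1 + (\<Sum>j\<in>?I. h j)" for h :: "nat \<Rightarrow> real"
    by (subst sum.atLeast_Suc_atMost) (auto simp: numeral_2_eq_2)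
  have "W1 (mixture ?I l' P') (P' 1) \<le> W1 (mixture ?I l P) (P 1)
    + (e (mixture ?I l P) + e (P 1) + e (mixture ?I l' P') + e (P' 1))
    + D * (V (mixture ?I l P) (mixture ?I l' P') + V (P 1) (P' 1))"
    unfolding e_def V_def using PI P P' int l0 l1
    by (intro W1_perturb borel_prob_mixture integral_mixture T F D fI) auto
  also have "\<dots> \<le> W1 (mixture ?I l P) (P 1)
    + ((\<Sum>j\<in>?I. e (P j)) + e (P 1) + (\<Sum>j\<in>?I. e (P' j)) + e (P' 1))
    + D * (((\<Sum>j\<in>?I. V (P j) (P' j)) + (\<Sum>j\<in>?I. \<bar>l j - l' j\<bar>)) + V (P 1) (P' 1))"
    using emix[OF l(1), of P] emix[OF l(2), of P'] PI
    by (intro add_mono mult_left_mono order_refl D0 Vmix) auto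
  also have "\<dots> = W1 (mixture ?I l P) (P 1) + (\<Sum>j=1..J+1. e (P j) + e (P' j) + D * V (P j) (P' j))
     + D * (\<Sum>j\<in>?I. \<bar>l j - l' j\<bar>)"
    unfolding split1 by (simp add: sum.distrib sum_distrib_left algebra_simps)
  finally show ?thesis unfolding e_def V_def .
qed

subsection \<open>Empirical measures\<close>

text \<open>The simple functions \<open>F i\<close> converge pointwise to the identity and stay
  within \<open>2 * dist x y0\<close> of \<open>y0\<close>. The error is thus dominated by the
  integrable \<open>3 * dist x y0\<close>, and dominated convergence applies. As \<open>I\<close> is
  finite, one \<open>i\<close> serves all \<open>j\<close>.\<close>

lemma exists_quantizer:
  fixes P :: "'i \<Rightarrow> 'a::polish_space measure"
  assumes I: "finite I" and P: "\<And>j. j \<in> I \<Longrightarrow> borel_prob (P j)"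
    and mom: "\<And>j. j \<in> I \<Longrightarrow> (\<integral>\<^sup>+ y. ennreal (dist y y0) \<partial>P j) < \<infinity>" and \<delta>: "0 < \<delta>"
  obtains T D where "T \<in> borel_measurable borel" "finite (range T)" "0 \<le> D" "\<And>x y. dist (T x) (T y) \<le> D"
    "\<And>j. j \<in> I \<Longrightarrow> integrable (P j) (\<lambda>x. dist x (T x))"
    "\<And>j. j \<in> I \<Longrightarrow> (\<integral>x. dist x (T x) \<partial>P j) \<le> \<delta>"
proof -
  obtain F where F: "\<And>i. simple_function (borel :: 'a measure) (F i)" "\<And>x. (\<lambda>i. F i x) \<longlonglongrightarrow> x"
    "\<And>i x. dist (F i x) y0 \<le> 2 * dist x y0"
    using borel_measurable_implies_sequence_metric[of "\<lambda>x::'a. x" borel y0] by auto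
  have Fm[measurable]: "F i \<in> borel_measurable borel" for i
    using F(1) by (rule borel_measurable_simple_function)
  have Ffin: "finite (range (F i))" for i using simple_functionD(1)[OF F(1)[of i]] by simp
  have bound: "dist x (F i x) \<le> 3 * dist x y0" for i x
    using F(3)[of i x] dist_triangle[of x "F i x" y0] by (simp add: dist_commute)
  have conv: "integrable (P j) (\<lambda>x. dist x (F i x)) \<and> (\<lambda>i. \<integral>x. dist x (F i x) \<partial>P j) \<longlonglongrightarrow> 0"
    if j: "j \<in> I" for i j
  proof -
    note [measurable_cong] = borel_probD(2)[OF P[OF j]]
    have w: "integrable (P j) (\<lambda>x. 3 * dist x y0)"
      using mom[OF j] by (intro integrable_mult_right integrableI_nonneg) auto
    have "integrable (P j) (\<lambda>x. dist x (F i x))"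
      by (rule Bochner_Integration.integrable_bound[OF w]) (use bound[of _ i] in auto)
    moreover have "(\<lambda>i. \<integral>x. dist x (F i x) \<partial>P j) \<longlonglongrightarrow> (\<integral>x. 0 \<partial>P j)"
    proof (rule integral_dominated_convergence[OF _ _ w])
      show "AE x in P j. (\<lambda>i. dist x (F i x)) \<longlonglongrightarrow> 0"
        using tendsto_dist[OF tendsto_const F(2)] by (intro AE_I2) (metis dist_self)
    qed (use bound in auto)
    ultimately show ?thesis by simp
  qed
  have "\<forall>\<^sub>F i in sequentially. \<forall>j\<in>I. (\<integral>x. dist x (F i x) \<partial>P j) < \<delta>"
    using conv \<delta> by (intro eventually_ball_finite[OF I] ballI order_tendstoD(2)[where y=0]) auto
  then obtain i where i: "\<And>j. j \<in> I \<Longrightarrow> (\<integral>x. dist x (F i x) \<partial>P j) < \<delta>"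
    using eventually_happens'[OF sequentially_bot] by blast
  have "dist (F i x) (F i y) \<le> diameter (range (F i))" for x y
    using diameter_bounded_bound[OF finite_imp_bounded[OF Ffin]] by blast
  moreover from this[of undefined undefined] have "0 \<le> diameter (range (F i))" by simp
  ultimately show thesis
    using that[of "F i" "diameter (range (F i))"] Fm Ffin conv i by (meson less_imp_le)
qed

section \<open>Cell probabilities and integrals under empirical measures\<close>

lemma borel_prob_return: "borel_prob (return borel y)"
  by (simp add: borel_prob_def prob_space_return)

lemma borel_prob_empirical:
  assumes "N \<ge> 1"
  shows "borel_prob (empirical N y)"
  unfolding empirical_def using assms by (intro borel_prob_mixture borel_prob_return) auto

lemma measure_empirical:
  assumes "A \<in> sets borel"
  shows "measure (empirical N y) A = (\<Sum>k=1..N. indicator A (y k)) / real N"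
  unfolding empirical_def using assms
  by (subst measure_mixture) (auto simp: borel_prob_return measure_return sum_divide_distrib)

lemma integral_empirical:
  assumes f[measurable]: "f \<in> borel_measurable borel" and f0: "\<And>x. 0 \<le> (f x :: real)"
  shows "integrable (empirical N y) f" "(\<integral>x. f x \<partial>empirical N y) = (\<Sum>k=1..N. f (y k)) / real N"
proof -
  have "integrable (return borel (y k)) f" for k
    using f0 by (intro integrableI_nonneg) (auto simp: nn_integral_return)
  then show "integrable (empirical N y) f" "(\<integral>x. f x \<partial>empirical N y) = (\<Sum>k=1..N. f (y k)) / real N"
    unfolding empirical_def using f0
    by (auto simp: integral_mixture borel_prob_return integral_return sum_divide_distrib)
qed

section \<open>Expected errors of empirical measures\<close>

context prob_space
begin

text \<open>When one variable is added, independence turns the expected cross term into a product of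
  expectations, which is 0 by centering; the new square contributes at most 1.\<close>

lemma expectation_square_indep_sum_le:
  fixes Z :: "'i \<Rightarrow> 'a \<Rightarrow> real"
  assumes "finite I" "indep_vars (\<lambda>_. borel) Z I"
    and "\<And>i \<omega>. i \<in> I \<Longrightarrow> \<bar>Z i \<omega>\<bar> \<le> 1" "\<And>i. i \<in> I \<Longrightarrow> expectation (Z i) = 0"
  shows "expectation (\<lambda>\<omega>. (\<Sum>i\<in>I. Z i \<omega>)\<^sup>2) \<le> card I"
  using assms
proof (induction I rule: finite_induct)
  case (insert i I)
  let ?S = "\<lambda>\<omega>. \<Sum>i\<in>I. Z i \<omega>"
  have meas[measurable]: "Z j \<in> borel_measurable M" if "j \<in> insert i I" for j
    using insert.prems(1) that by (auto simp: indep_vars_def)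
  have int: "integrable M (Z j)" if "j \<in> insert i I" for j
    using insert.prems(2)[OF that] meas[OF that] by (intro integrable_const_bound[where B=1]) auto
  have S_bound: "\<bar>?S \<omega>\<bar> \<le> card I" for \<omega>
    using insert.prems(2) by (intro order_trans[OF sum_abs] order_trans[OF sum_bounded_above[where K=1]]) auto
  have [measurable]: "?S \<in> borel_measurable M" by (intro borel_measurable_sum meas) auto
  have [measurable]: "Z i \<in> borel_measurable M" by (intro meas) auto
  have intS: "integrable M ?S" using int by auto
  have intS2: "integrable M (\<lambda>\<omega>. (?S \<omega>)\<^sup>2)"
    using S_bound by (intro integrable_const_bound[where B="(real (card I))\<^sup>2"]) (auto simp: abs_le_square_iff[symmetric])
  have intZ2: "integrable M (\<lambda>\<omega>. (Z i \<omega>)\<^sup>2)"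
    using insert.prems(2)[of i] by (intro integrable_const_bound[where B=1]) (auto simp: abs_square_le_1)
  have ind: "indep_var borel (Z i) borel ?S"
    using insert by (intro indep_vars_sum) auto
  have ES: "expectation ?S = 0" using int insert.prems(3) by simp
  have "expectation (\<lambda>\<omega>. (\<Sum>i\<in>insert i I. Z i \<omega>)\<^sup>2) =
      expectation (\<lambda>\<omega>. (Z i \<omega>)\<^sup>2 + 2 * (Z i \<omega> * ?S \<omega>) + (?S \<omega>)\<^sup>2)"
    using insert.hyps by (intro Bochner_Integration.integral_cong) (auto simp: power2_eq_square algebra_simps)
  also have "\<dots> = expectation (\<lambda>\<omega>. (Z i \<omega>)\<^sup>2) + 2 * (expectation (Z i) * expectation ?S)
      + expectation (\<lambda>\<omega>. (?S \<omega>)\<^sup>2)"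
    using indep_var_lebesgue_integral[OF ind int[of i] intS] indep_var_integrable[OF ind int[of i] intS] intS2 intZ2
    by simp
  also have "\<dots> \<le> 1 + 2 * 0 + real (card I)"
  proof (intro add_mono)
    have "expectation (\<lambda>\<omega>. (Z i \<omega>)\<^sup>2) \<le> expectation (\<lambda>_. 1)"
      using intZ2 insert.prems(2)[of i] by (intro integral_mono) (auto simp: abs_square_le_1)
    then show "expectation (\<lambda>\<omega>. (Z i \<omega>)\<^sup>2) \<le> 1" by (simp add: prob_space)
    show "expectation (\<lambda>\<omega>. (?S \<omega>)\<^sup>2) \<le> card I"
      using insert.prems by (intro insert.IH indep_vars_subset[OF insert.prems(1)]) auto
  qed (simp add: ES)
  finally show ?case using insert.hyps by simp
qed simp

text \<open>The deviation is \<open>1 / N\<close> times a sum \<open>S\<close> of independent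
  centred variables bounded by 1. Its second moment is at most \<open>N\<close>, so its first
  absolute moment is at most \<open>sqrt N\<close>.\<close>

lemma empirical_measure_L1:
  fixes X :: "nat \<Rightarrow> 'a \<Rightarrow> 'b::polish_space"
  assumes N: "N \<ge> 1" and ind: "indep_vars (\<lambda>_. borel) X {1..N}"
    and distr: "\<And>k. k \<in> {1..N} \<Longrightarrow> distr M borel (X k) = \<mu>" and A: "A \<in> sets borel"
  shows "integrable M (\<lambda>\<omega>. \<bar>measure \<mu> A - measure (empirical N (\<lambda>k. X k \<omega>)) A\<bar>)"
    and "expectation (\<lambda>\<omega>. \<bar>measure \<mu> A - measure (empirical N (\<lambda>k. X k \<omega>)) A\<bar>) \<le> 1 / sqrt N"
proof -
  have X[measurable]: "X k \<in> borel_measurable M" if "k \<in> {1..N}" for k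
    using ind that by (auto simp: indep_vars_def)
  have meas_eq: "measure \<mu> A = expectation (\<lambda>\<omega>. indicator A (X k \<omega>))" if k: "k \<in> {1..N}" for k
  proof -
    have "measure \<mu> A = measure M (X k -` A \<inter> space M)"
      unfolding distr[OF k, symmetric] using X[OF k] A by (intro measure_distr)
    also have "\<dots> = expectation (indicator (X k -` A \<inter> space M))" by simp
    also have "\<dots> = expectation (\<lambda>\<omega>. indicator A (X k \<omega>))"
      by (intro Bochner_Integration.integral_cong) (auto simp: indicator_def)
    finally show ?thesis .
  qed
  have p: "0 \<le> measure \<mu> A" "measure \<mu> A \<le> 1"
    using distr[of 1] N X[of 1] by (auto intro!: prob_space.prob_le_1 prob_space_distr)
  define Z where "Z k \<omega> = indicator A (X k \<omega>) - measure \<mu> A" for k \<omega>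
  define S where "S \<omega> = (\<Sum>k\<in>{1..N}. Z k \<omega>)" for \<omega>
  have indm: "(\<lambda>\<omega>. indicator A (X k \<omega>) :: real) \<in> borel_measurable M" if "k \<in> {1..N}" for k
    using X[OF that] A by measurable
  have Zb: "\<bar>Z k \<omega>\<bar> \<le> 1" for k \<omega> using p by (auto simp: Z_def indicator_def)
  have EZ: "expectation (Z k) = 0" if "k \<in> {1..N}" for k
  proof -
    have "integrable M (\<lambda>\<omega>. indicator A (X k \<omega>) :: real)"
      using indm[OF that] by (intro integrable_const_bound[where B=1]) (auto simp: indicator_def)
    then show ?thesis using meas_eq[OF that] unfolding Z_def by (simp add: prob_space)
  qed
  have indZ: "indep_vars (\<lambda>_. borel) Z {1..N}"
    unfolding Z_def using A
    by (intro indep_vars_compose2[OF ind, where Y="\<lambda>_ x. indicator A x - measure \<mu> A"]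
        borel_measurable_diff borel_measurable_indicator borel_measurable_const)
  have ES2: "expectation (\<lambda>\<omega>. (S \<omega>)\<^sup>2) \<le> N"
    unfolding S_def using expectation_square_indep_sum_le[OF _ indZ] Zb EZ by simp
  have Sm[measurable]: "S \<in> borel_measurable M"
    unfolding S_def Z_def using indm by measurable
  have Sb: "\<bar>S \<omega>\<bar> \<le> N" for \<omega>
    unfolding S_def using Zb by (intro order_trans[OF sum_abs] order_trans[OF sum_bounded_above[where K=1]]) auto
  have eq: "\<bar>measure \<mu> A - measure (empirical N (\<lambda>k. X k \<omega>)) A\<bar> = \<bar>S \<omega>\<bar> / N" for \<omega>
  proof -
    have "(\<Sum>k=1..N. indicator A (X k \<omega>)) = S \<omega> + N * measure \<mu> A"
      by (simp add: S_def Z_def sum_subtractf)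
    then have "measure \<mu> A - measure (empirical N (\<lambda>k. X k \<omega>)) A = - S \<omega> / N"
      unfolding measure_empirical[OF A] using N by (simp add: add_divide_distrib)
    then show ?thesis by simp
  qed
  have intS: "integrable M (\<lambda>\<omega>. \<bar>S \<omega>\<bar>)" using Sb by (intro integrable_const_bound[where B=N]) auto
  have intS2: "integrable M (\<lambda>\<omega>. (S \<omega>)\<^sup>2)"
    using Sb by (intro integrable_const_bound[where B="(real N)\<^sup>2"]) (auto simp: abs_le_square_iff[symmetric])
  show "integrable M (\<lambda>\<omega>. \<bar>measure \<mu> A - measure (empirical N (\<lambda>k. X k \<omega>)) A\<bar>)"
    unfolding eq using intS by simp
  have N0: "0 < sqrt N" using N by simp
  \<comment> \<open>The pointwise arithmetic-geometric mean inequality, scaled by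
    \<open>sqrt N\<close>, plays the part of Cauchy-Schwarz: both halves of the bound have
    expectation at most \<open>sqrt N / 2\<close>.\<close>
  have "expectation (\<lambda>\<omega>. \<bar>S \<omega>\<bar>) \<le> expectation (\<lambda>\<omega>. (sqrt N + (S \<omega>)\<^sup>2 / sqrt N) / 2)"
  proof (intro integral_mono)
    fix \<omega>
    have "0 \<le> (\<bar>S \<omega>\<bar> - sqrt N)\<^sup>2" by simp
    then have "2 * \<bar>S \<omega>\<bar> * sqrt N \<le> sqrt N * sqrt N + (S \<omega>)\<^sup>2"
      by (simp add: power2_eq_square algebra_simps)
    then show "\<bar>S \<omega>\<bar> \<le> (sqrt N + (S \<omega>)\<^sup>2 / sqrt N) / 2"
      using N0 by (simp add: field_simps)
  qed (use intS intS2 in auto)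
  also have "\<dots> = (sqrt N + expectation (\<lambda>\<omega>. (S \<omega>)\<^sup>2) / sqrt N) / 2"
    using intS2 by (simp add: prob_space)
  also have "\<dots> \<le> (sqrt N + real N / sqrt N) / 2"
    using ES2 N0 by (intro divide_right_mono add_left_mono) auto
  also have "\<dots> = sqrt N" by (simp add: real_div_sqrt)
  finally have "expectation (\<lambda>\<omega>. \<bar>S \<omega>\<bar>) / N \<le> sqrt N / N" by (intro divide_right_mono) auto
  also have "sqrt N / N = 1 / sqrt N" using N by (simp add: field_simps)
  finally show "expectation (\<lambda>\<omega>. \<bar>measure \<mu> A - measure (empirical N (\<lambda>k. X k \<omega>)) A\<bar>) \<le> 1 / sqrt N"
    unfolding eq by simp
qed

text \<open>Each draw has law \<open>\<mu>\<close>, so by linearity the empirical integral is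
  unbiased. For \<open>f x = dist x (T x)\<close> this keeps the expected quantization error equal
  to that of \<open>\<mu>\<close>.\<close>

lemma expectation_integral_empirical:
  fixes X :: "nat \<Rightarrow> 'a \<Rightarrow> 'b::polish_space"
  assumes N: "N \<ge> 1" and X: "\<And>k. k \<in> {1..N} \<Longrightarrow> X k \<in> borel_measurable M"
    and distr: "\<And>k. k \<in> {1..N} \<Longrightarrow> distr M borel (X k) = \<mu>"
    and f[measurable]: "f \<in> borel_measurable borel" and f0: "\<And>x. 0 \<le> (f x :: real)" and int: "integrable \<mu> f"
  shows "integrable M (\<lambda>\<omega>. \<integral>x. f x \<partial>empirical N (\<lambda>k. X k \<omega>))"
    and "expectation (\<lambda>\<omega>. \<integral>x. f x \<partial>empirical N (\<lambda>k. X k \<omega>)) = (\<integral>x. f x \<partial>\<mu>)"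
proof -
  have i: "integrable M (\<lambda>\<omega>. f (X k \<omega>))" if "k \<in> {1..N}" for k
    using int X[OF that] unfolding distr[OF that, symmetric] by (subst (asm) integrable_distr_eq) auto
  have e: "expectation (\<lambda>\<omega>. f (X k \<omega>)) = (\<integral>x. f x \<partial>\<mu>)" if "k \<in> {1..N}" for k
    using X[OF that] unfolding distr[OF that, symmetric] by (subst integral_distr) auto
  show "integrable M (\<lambda>\<omega>. \<integral>x. f x \<partial>empirical N (\<lambda>k. X k \<omega>))"
    unfolding integral_empirical(2)[OF f f0] using i by (intro integrable_divide Bochner_Integration.integrable_sum) auto
  show "expectation (\<lambda>\<omega>. \<integral>x. f x \<partial>empirical N (\<lambda>k. X k \<omega>)) = (\<integral>x. f x \<partial>\<mu>)"
    unfolding integral_empirical(2)[OF f f0] using i e N by simp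
qed

end

text \<open>Only 0 needs an argument: with \<open>y = inverse x\<close> the function is
  \<open>- ln y / y\<close>, which tends to 0 as \<open>y\<close> grows. The value there is
  \<open>0 * ln 0 = 0\<close>, matching the entropy convention.\<close>

lemma continuous_on_x_ln_x: "continuous_on {0..} (\<lambda>x::real. x * ln x)"
proof (rule continuous_on_eq_continuous_within[THEN iffD2], rule ballI)
  fix x :: real assume x: "x \<in> {0..}"
  show "continuous (at x within {0..}) (\<lambda>x. x * ln x)"
  proof (cases "x = 0")
    case True
    have "((\<lambda>x::real. - (ln (inverse x) / inverse x)) \<longlongrightarrow> - 0) (at_right 0)"
      by (intro tendsto_minus filterlim_compose[OF ln_x_over_x_tendsto_0 filterlim_inverse_at_top_right])
    moreover have "\<forall>\<^sub>F x::real in at_right 0. - (ln (inverse x) / inverse x) = x * ln x"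
      using eventually_at_right_less[of 0] by eventually_elim (simp add: field_simps ln_div)
    ultimately have "((\<lambda>x::real. x * ln x) \<longlongrightarrow> 0) (at_right 0)"
      unfolding minus_zero by (rule Lim_transform_eventually)
    then show ?thesis by (simp add: True continuous_within at_within_Ici_at_right)
  next
    case False
    with x show ?thesis by (intro continuous_intros) auto
  qed
qed

subsection \<open>Consistency of the minimizer\<close>

declare sum.cl_ivl_Suc [simp del]

text \<open>Weights are functions on all of \<open>nat\<close>, and \<open>Simplex J\<close> leaves
  the coordinates outside \<open>{2..J+1}\<close> free. With these fixed at 0 the set is a closed
  part of a product of compact sets, so Tychonoff applies.\<close>

lemma compact_Simplex_supported:
  "compact {l \<in> Simplex J. \<forall>j. j \<notin> {2..J+1} \<longrightarrow> l j = 0}"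
proof -
  let ?B = "\<lambda>j. if j \<in> {2..J+1} then {0..1::real} else {0}"
  have "compactin (product_topology (\<lambda>_. euclidean) UNIV) (PiE UNIV ?B)"
    unfolding compactin_PiE by auto
  then have "compact (PiE UNIV ?B)"
    by (simp add: euclidean_product_topology)
  moreover have "closed {l :: nat \<Rightarrow> real. (\<Sum>j=2..J+1. l j) = 1}"
    by (intro closed_Collect_eq continuous_on_sum continuous_on_product_coordinates continuous_on_const)
  ultimately have "compact (PiE UNIV ?B \<inter> {l. (\<Sum>j=2..J+1. l j) = 1})"
    by (rule compact_Int_closed)
  also have "PiE UNIV ?B \<inter> {l. (\<Sum>j=2..J+1. l j) = 1} = {l \<in> Simplex J. \<forall>j. j \<notin> {2..J+1} \<longrightarrow> l j = 0}"
  proof (intro equalityI subsetI)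
    fix l assume l: "l \<in> {l \<in> Simplex J. \<forall>j. j \<notin> {2..J+1} \<longrightarrow> l j = 0}"
    then have "l j \<le> 1" if "j \<in> {2..J+1}" for j
      using member_le_sum[of j "{2..J+1}" l] that by (auto simp: Simplex_def)
    with l show "l \<in> PiE UNIV ?B \<inter> {l. (\<Sum>j=2..J+1. l j) = 1}"
      unfolding Simplex_def PiE_UNIV_domain by auto
  next
    fix l assume l: "l \<in> PiE UNIV ?B \<inter> {l. (\<Sum>j=2..J+1. l j) = 1}"
    then have "l j \<in> ?B j" for j unfolding PiE_UNIV_domain by blast
    then have "(j \<in> {2..J+1} \<longrightarrow> 0 \<le> l j) \<and> (j \<notin> {2..J+1} \<longrightarrow> l j = 0)" for j
      by (metis atLeastAtMost_iff singletonD)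
    with l show "l \<in> {l \<in> Simplex J. \<forall>j. j \<notin> {2..J+1} \<longrightarrow> l j = 0}"
      unfolding Simplex_def by blast
  qed
  finally show ?thesis .
qed

text \<open>With the measures unchanged, the cell terms of \<open>W1_mixture_perturb\<close> vanish.
  What remains is an arbitrarily small quantization error and \<open>D\<close> times the
  \<open>l1\<close> distance of the weights.\<close>

lemma continuous_on_Q_obj:
  fixes P :: "nat \<Rightarrow> 'a::polish_space measure"
  assumes P: "\<And>j. j \<in> {1..J+1} \<Longrightarrow> borel_prob (P j)"
    and mom: "\<And>j. j \<in> {1..J+1} \<Longrightarrow> (\<integral>\<^sup>+ y. ennreal (dist y y0) \<partial>P j) < \<infinity>"
  shows "continuous_on (Simplex J) (Q_obj J \<eta> P)"
proof -
  let ?W = "\<lambda>l. W1 (mixture {2..J+1} l P) (P 1)"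
  have W: "continuous_on (Simplex J) ?W"
    unfolding continuous_on_def
  proof (intro ballI tendstoI)
    fix l and r :: real assume l: "l \<in> Simplex J" and r: "0 < r"
    \<comment> \<open>Each of the \<open>J + 1\<close> measures contributes its quantization error
      twice, in total at most \<open>r / 2\<close>; the other half of \<open>r\<close> is left for
      the change of weights.\<close>
    define \<delta> where "\<delta> = r / (4 * (real J + 1))"
    have \<delta>: "0 < \<delta>" using r by (simp add: \<delta>_def)
    obtain T D where T: "T \<in> borel_measurable borel" "finite (range T)" "0 \<le> D" "\<And>x y. dist (T x) (T y) \<le> D"
      "\<And>j. j \<in> {1..J+1} \<Longrightarrow> integrable (P j) (\<lambda>x. dist x (T x))"
      "\<And>j. j \<in> {1..J+1} \<Longrightarrow> (\<integral>x. dist x (T x) \<partial>P j) \<le> \<delta>"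
      by (rule exists_quantizer[where I="{1..J+1}" and P=P and ?y0.0=y0 and \<delta>=\<delta>,
            OF finite_atLeastAtMost P mom \<delta>]) (assumption | rule that; simp)+
    have "(\<Sum>j=1..J+1. (\<integral>x. dist x (T x) \<partial>P j) + (\<integral>x. dist x (T x) \<partial>P j)) \<le> (\<Sum>j=1..J+1. \<delta> + \<delta>)"
      using T(6) by (intro sum_mono add_mono) auto
    also have "\<dots> = 2 * ((real J + 1) * \<delta>)" by (simp add: algebra_simps)
    also have "\<dots> = r / 2" by (simp add: \<delta>_def divide_simps)
    finally have small: "(\<Sum>j=1..J+1. (\<integral>x. dist x (T x) \<partial>P j) + (\<integral>x. dist x (T x) \<partial>P j)) \<le> r / 2" .
    have W_le: "?W l2 \<le> ?W l1 + r / 2 + D * (\<Sum>j=2..J+1. \<bar>l1 j - l2 j\<bar>)"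
      if "l1 \<in> Simplex J" "l2 \<in> Simplex J" for l1 l2
      using W1_mixture_perturb[where P=P and P'=P, OF P P T(1,2,5,5,4) that] small by simp
    have "((\<lambda>m. D * (\<Sum>j=2..J+1. \<bar>l j - m j\<bar>)) \<longlongrightarrow> D * (\<Sum>j=2..J+1. \<bar>l j - l j\<bar>)) (at l within Simplex J)"
      using continuous_on_subset[OF continuous_on_product_coordinates subset_UNIV, of "Simplex J"] l
      by (intro tendsto_intros) (auto simp: continuous_on_def)
    then have "\<forall>\<^sub>F m in at l within Simplex J. D * (\<Sum>j=2..J+1. \<bar>l j - m j\<bar>) < r / 2"
      using r by (intro order_tendstoD(2)[where y=0]) auto
    moreover have "\<forall>\<^sub>F m in at l within Simplex J. m \<in> Simplex J"
      by (simp add: eventually_at_filter)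
    ultimately show "\<forall>\<^sub>F m in at l within Simplex J. dist (?W m) (?W l) < r"
    proof eventually_elim
      case (elim m)
      then show ?case
        using W_le[OF l, of m] W_le[OF _ l, of m] by (simp add: dist_real_def abs_minus_commute)
    qed
  qed
  have coord: "continuous_on (Simplex J) (\<lambda>l. l j * ln (l j))" if "j \<in> {2..J+1}" for j
    by (rule continuous_on_compose2[OF continuous_on_x_ln_x
          continuous_on_subset[OF continuous_on_product_coordinates subset_UNIV]])
       (use that in \<open>auto simp: Simplex_def\<close>)
  show ?thesis
    unfolding Q_obj_def by (intro continuous_on_add continuous_on_mult continuous_on_const continuous_on_sum W coord)
qed

text \<open>Allows arbitrary weights to be replaced by ones vanishing outside
  \<open>{2..J+1}\<close>, where compactness is available.\<close>

lemma Q_obj_cong: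
  assumes "\<And>j. j \<in> {2..J+1} \<Longrightarrow> l j = l' j"
  shows "Q_obj J \<eta> P l = Q_obj J \<eta> P l'"
proof -
  have "(\<lambda>A. \<Sum>i\<in>{2..J+1}. ennreal (l i) * emeasure (P i) A) = (\<lambda>A. \<Sum>i\<in>{2..J+1}. ennreal (l' i) * emeasure (P i) A)"
    using assms by (intro ext sum.cong) auto
  then have "mixture {2..J+1} l P = mixture {2..J+1} l' P" by (simp only: mixture_def)
  moreover have "(\<Sum>j=2..J+1. l j * ln (l j)) = (\<Sum>j=2..J+1. l' j * ln (l' j))"
    using assms by (intro sum.cong) auto
  ultimately show ?thesis by (simp only: Q_obj_def)
qed

text \<open>The zero-padded weights at distance at least \<open>\<epsilon>\<close> from
  \<open>l0\<close> form a compact set \<open>K\<close>. The continuous objective attains its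
  minimum on \<open>K\<close>, by uniqueness strictly above its value at \<open>l0\<close>, and
  \<open>\<kappa>\<close> is this gap.\<close>

lemma Q_obj_minimizer_well_separated:
  fixes P :: "nat \<Rightarrow> 'a::polish_space measure"
  assumes P: "\<And>j. j \<in> {1..J+1} \<Longrightarrow> borel_prob (P j)"
    and mom: "\<And>j. j \<in> {1..J+1} \<Longrightarrow> (\<integral>\<^sup>+ y. ennreal (dist y y0) \<partial>P j) < \<infinity>"
    and unique: "\<forall>l\<in>Simplex J. Q_obj J \<eta> P l \<le> Q_obj J \<eta> P l0 \<longrightarrow> (\<forall>j\<in>{2..J+1}. l j = l0 j)"
    and \<epsilon>: "0 < \<epsilon>"
  obtains \<kappa> where "0 < \<kappa>"
    "\<And>l. l \<in> Simplex J \<Longrightarrow> \<epsilon> \<le> (\<Sum>j=2..J+1. \<bar>l j - l0 j\<bar>) \<Longrightarrow> Q_obj J \<eta> P l0 + \<kappa> \<le> Q_obj J \<eta> P l"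
proof -
  let ?d = "\<lambda>l. \<Sum>j=2..J+1. \<bar>l j - l0 j\<bar>"
  let ?r = "\<lambda>(l::nat \<Rightarrow> real) j. if j \<in> {2..J+1} then l j else 0"
  define K where "K = {l \<in> Simplex J. \<forall>j. j \<notin> {2..J+1} \<longrightarrow> l j = 0} \<inter> {l. \<epsilon> \<le> ?d l}"
  have r: "Q_obj J \<eta> P l = Q_obj J \<eta> P (?r l)" for l by (rule Q_obj_cong) simp
  have rK: "?r l \<in> K" if "l \<in> Simplex J" "\<epsilon> \<le> ?d l" for l
  proof -
    have "?d (?r l) = ?d l" "(\<Sum>j=2..J+1. ?r l j) = (\<Sum>j=2..J+1. l j)" by (auto intro!: sum.cong)
    then show ?thesis using that unfolding K_def Simplex_def by auto
  qed
  have "closed {l. \<epsilon> \<le> ?d l}"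
    by (intro closed_Collect_le continuous_intros continuous_on_product_coordinates)
  then have K: "compact K" unfolding K_def by (intro compact_Int_closed compact_Simplex_supported)
  have cont: "continuous_on K (Q_obj J \<eta> P)"
    by (rule continuous_on_subset[OF continuous_on_Q_obj[OF P mom]]) (auto simp: K_def)
  show thesis
  proof (cases "K = {}")
    \<comment> \<open>No weights are that far from \<open>l0\<close>, so the claim is vacuous and
      \<open>\<kappa> = 1\<close> is an arbitrary choice.\<close>
    case True
    then show thesis using that[of 1] rK by auto
  next
    case False
    then obtain m where m: "m \<in> K" "\<And>l. l \<in> K \<Longrightarrow> Q_obj J \<eta> P m \<le> Q_obj J \<eta> P l"
      using continuous_attains_inf[OF K _ cont] by blast
    have "Q_obj J \<eta> P l0 < Q_obj J \<eta> P m"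
    proof (rule ccontr)
      assume "\<not> ?thesis"
      with m(1) unique have "\<forall>j\<in>{2..J+1}. m j = l0 j" by (auto simp: K_def)
      then have "?d m = 0" by simp
      with m(1) \<epsilon> show False by (simp add: K_def)
    qed
    then show thesis using that[of "Q_obj J \<eta> P m - Q_obj J \<eta> P l0"] m(2)[OF rK] r by simp
  qed
qed

section \<open>Convergence in probability of the empirical minimizers\<close>

theorem theorem3:
  fixes J :: nat and \<eta> :: real
    and P :: "nat \<Rightarrow> 'a::polish_space measure"
    and M :: "'w measure"
    and Y :: "nat \<Rightarrow> nat \<Rightarrow> nat \<Rightarrow> 'w \<Rightarrow> 'a"
    and lam_hat :: "nat \<Rightarrow> 'w \<Rightarrow> nat \<Rightarrow> real"
    and lam_star :: "nat \<Rightarrow> real"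
  assumes J: "J \<ge> 1"
    and P_prob: "\<And>j. j \<in> {1..J+1} \<Longrightarrow> borel_prob (P j)"
    and moment: "\<exists>y0. \<forall>j\<in>{1..J+1}. (\<integral>\<^sup>+ y. ennreal (dist y y0) \<partial>P j) < \<infinity>"
    and aff: "affinely_indep J P"
    and eta: "\<eta> > 0"
    and M: "prob_space M"
    and Y_meas: "\<And>N j k. Y N j k \<in> borel_measurable M"
    and Y_indep: "\<And>N j. N \<ge> 1 \<Longrightarrow> j \<in> {1..J+1} \<Longrightarrow>
        prob_space.indep_vars M (\<lambda>_. borel) (\<lambda>k. Y N j k) {1..N}"
    and Y_distr: "\<And>N j k. N \<ge> 1 \<Longrightarrow> j \<in> {1..J+1} \<Longrightarrow> k \<in> {1..N} \<Longrightarrow>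
        distr M borel (Y N j k) = P j"
    and lam_hat_meas: "\<And>N j. N \<ge> 1 \<Longrightarrow> (\<lambda>\<omega>. lam_hat N \<omega> j) \<in> borel_measurable M"
    and lam_hat_min: "\<And>N \<omega>. N \<ge> 1 \<Longrightarrow> \<omega> \<in> space M \<Longrightarrow>
        lam_hat N \<omega> \<in> Simplex J \<and>
        (\<forall>l\<in>Simplex J. Q_obj J \<eta> (\<lambda>j. empirical N (\<lambda>k. Y N j k \<omega>)) (lam_hat N \<omega>)
                      \<le> Q_obj J \<eta> (\<lambda>j. empirical N (\<lambda>k. Y N j k \<omega>)) l)"
    and lam_star: "lam_star \<in> Simplex J"
      "\<forall>l\<in>Simplex J. Q_obj J \<eta> P lam_star \<le> Q_obj J \<eta> P l"
    and unique: "\<forall>l\<in>Simplex J. Q_obj J \<eta> P l \<le> Q_obj J \<eta> P lam_star \<longrightarrow> (\<forall>j\<in>{2..J+1}. l j = lam_star j)"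
  shows "\<forall>\<epsilon>>0. (\<lambda>N. measure M {\<omega>\<in>space M. (\<Sum>j=2..J+1. \<bar>lam_hat N \<omega> j - lam_star j\<bar>) > \<epsilon>})
            \<longlonglongrightarrow> 0"
proof (intro allI impI)
  fix \<epsilon> :: real assume \<epsilon>: "0 < \<epsilon>"
  interpret prob_space M by fact
  obtain y0 where mom: "\<And>j. j \<in> {1..J+1} \<Longrightarrow> (\<integral>\<^sup>+ y. ennreal (dist y y0) \<partial>P j) < \<infinity>"
    using moment by blast
  obtain \<kappa> where \<kappa>: "0 < \<kappa>"
    "\<And>l. l \<in> Simplex J \<Longrightarrow> \<epsilon> \<le> (\<Sum>j=2..J+1. \<bar>l j - lam_star j\<bar>) \<Longrightarrow>
       Q_obj J \<eta> P lam_star + \<kappa> \<le> Q_obj J \<eta> P l"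
    by (rule Q_obj_minimizer_well_separated[OF P_prob mom unique \<epsilon>]; blast)
  let ?B = "\<lambda>N. {\<omega>\<in>space M. (\<Sum>j=2..J+1. \<bar>lam_hat N \<omega> j - lam_star j\<bar>) > \<epsilon>}"
  show "(\<lambda>N. measure M (?B N)) \<longlonglongrightarrow> 0"
  proof (rule order_tendstoI)
    fix \<theta> :: real assume \<theta>: "0 < \<theta>"
    \<comment> \<open>Chosen so that the part of the final bound coming from quantization,
      \<open>(J + 1) * 2 * \<delta> / (\<kappa> / 3)\<close>, equals
      \<open>\<theta> / 2\<close>.\<close>
    define \<delta> where "\<delta> = \<kappa> * \<theta> / (12 * (real J + 1))"
    have \<delta>: "0 < \<delta>" using \<kappa> \<theta> by (simp add: \<delta>_def)
    obtain T D where T: "T \<in> borel_measurable borel" "finite (range T)" "0 \<le> D" "\<And>x y. dist (T x) (T y) \<le> D"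
      "\<And>j. j \<in> {1..J+1} \<Longrightarrow> integrable (P j) (\<lambda>x. dist x (T x))"
      "\<And>j. j \<in> {1..J+1} \<Longrightarrow> (\<integral>x. dist x (T x) \<partial>P j) \<le> \<delta>"
      by (rule exists_quantizer[where I="{1..J+1}" and P=P and ?y0.0=y0 and \<delta>=\<delta>,
            OF finite_atLeastAtMost P_prob mom \<delta>]) (assumption | rule that; simp)+
    note [measurable] = T(1)
    have Tm: "T -` {a} \<in> sets borel" for a using measurable_sets[OF T(1), of "{a}"] by simp
    define emp where "emp N \<omega> j = empirical N (\<lambda>k. Y N j k \<omega>)" for N \<omega> j
    \<comment> \<open>This is the error of \<open>W1_mixture_perturb\<close> for equal weights. It
      contains no weights, so it controls the objectives at \<open>lam_star\<close> and at the
      random \<open>lam_hat N \<omega>\<close> alike.\<close>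
    define R where "R N \<omega> = (\<Sum>j=1..J+1. (\<integral>x. dist x (T x) \<partial>P j) + (\<integral>x. dist x (T x) \<partial>emp N \<omega> j)
      + D * (\<Sum>a\<in>range T. \<bar>measure (P j) (T -` {a}) - measure (emp N \<omega> j) (T -` {a})\<bar>))" for N \<omega>
    have bound: "measure M (?B N) \<le> (real J + 1) * (2 * \<delta> + D * card (range T) / sqrt N) / (\<kappa> / 3)"
      if N: "N \<ge> 1" for N
    proof -
      \<comment> \<open>Passing from \<open>P\<close> to the empirical measures at
        \<open>lam_star\<close> and back at \<open>lam_hat\<close> costs \<open>R\<close> each time,
        and empirical optimality links the two. A minimizer off by more than
        \<open>\<epsilon>\<close> would need \<open>\<kappa> \<le> 2 * R\<close>, which
        \<open>R < \<kappa> / 3\<close> excludes.\<close>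
      have incl: "?B N \<subseteq> {\<omega>\<in>space M. \<kappa> / 3 \<le> R N \<omega>}"
      proof (safe, rule ccontr)
        fix \<omega> assume \<omega>: "\<omega> \<in> space M" "\<epsilon> < (\<Sum>j=2..J+1. \<bar>lam_hat N \<omega> j - lam_star j\<bar>)" "\<not> \<kappa> / 3 \<le> R N \<omega>"
        have emp: "borel_prob (emp N \<omega> j)" "integrable (emp N \<omega> j) (\<lambda>x. dist x (T x))" for j
          unfolding emp_def using N by (auto intro!: borel_prob_empirical integral_empirical)
        have lam: "lam_hat N \<omega> \<in> Simplex J" "Q_obj J \<eta> (emp N \<omega>) (lam_hat N \<omega>) \<le> Q_obj J \<eta> (emp N \<omega>) lam_star"
          using lam_hat_min[OF N \<omega>(1)] lam_star(1) unfolding emp_def by auto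
        have up: "Q_obj J \<eta> (emp N \<omega>) lam_star \<le> Q_obj J \<eta> P lam_star + R N \<omega>"
          using W1_mixture_perturb[OF P_prob emp(1) T(1,2,5) emp(2) T(4) lam_star(1) lam_star(1)]
          unfolding Q_obj_def R_def by simp
        have down: "Q_obj J \<eta> P (lam_hat N \<omega>) \<le> Q_obj J \<eta> (emp N \<omega>) (lam_hat N \<omega>) + R N \<omega>"
        proof -
          have R': "R N \<omega> = (\<Sum>j=1..J+1. (\<integral>x. dist x (T x) \<partial>emp N \<omega> j) + (\<integral>x. dist x (T x) \<partial>P j)
            + D * (\<Sum>a\<in>range T. \<bar>measure (emp N \<omega> j) (T -` {a}) - measure (P j) (T -` {a})\<bar>))"
            unfolding R_def by (simp only: abs_minus_commute add.commute)
          show ?thesis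
            using W1_mixture_perturb[OF emp(1) P_prob T(1,2) emp(2) T(5,4) lam(1) lam(1)]
            unfolding Q_obj_def R' by simp
        qed
        have "Q_obj J \<eta> P lam_star + \<kappa> \<le> Q_obj J \<eta> P (lam_hat N \<omega>)"
          using \<kappa>(2)[OF lam(1)] \<omega>(2) by simp
        with up down lam(2) \<omega>(3) \<kappa>(1) show False by linarith
      qed
      have L1: "integrable M (\<lambda>\<omega>. \<bar>measure (P j) (T -` {a}) - measure (emp N \<omega> j) (T -` {a})\<bar>)"
        "expectation (\<lambda>\<omega>. \<bar>measure (P j) (T -` {a}) - measure (emp N \<omega> j) (T -` {a})\<bar>) \<le> 1 / sqrt N"
        if "j \<in> {1..J+1}" for j a
        unfolding emp_def
        by (rule empirical_measure_L1[OF N Y_indep[OF N that] Y_distr[OF N that] Tm], assumption)+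
      have EI: "integrable M (\<lambda>\<omega>. \<integral>x. dist x (T x) \<partial>emp N \<omega> j)"
        "expectation (\<lambda>\<omega>. \<integral>x. dist x (T x) \<partial>emp N \<omega> j) = (\<integral>x. dist x (T x) \<partial>P j)"
        if "j \<in> {1..J+1}" for j
        unfolding emp_def
        by (rule expectation_integral_empirical[OF N Y_meas Y_distr[OF N that] _ _ T(5)[OF that]]; simp)+
      have intR: "integrable M (R N)"
        unfolding R_def
        by (intro Bochner_Integration.integrable_sum Bochner_Integration.integrable_add integrable_mult_right
            integrable_const L1(1) EI(1))
      have R0: "0 \<le> R N \<omega>" for \<omega>
        unfolding R_def using T(3) by (intro sum_nonneg add_nonneg_nonneg mult_nonneg_nonneg) auto
      have "expectation (R N) = (\<Sum>j=1..J+1. (\<integral>x. dist x (T x) \<partial>P j) + (\<integral>x. dist x (T x) \<partial>P j)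
          + D * (\<Sum>a\<in>range T. expectation (\<lambda>\<omega>. \<bar>measure (P j) (T -` {a}) - measure (emp N \<omega> j) (T -` {a})\<bar>)))"
        unfolding R_def using L1(1) EI by (simp add: prob_space)
      also have "\<dots> \<le> (\<Sum>j=1..J+1. \<delta> + \<delta> + D * (\<Sum>a\<in>range T. 1 / sqrt N))"
        using L1(2) T(3,6) by (intro sum_mono add_mono mult_left_mono) auto
      also have "\<dots> = (real J + 1) * (2 * \<delta> + D * card (range T) / sqrt N)"
        by simp
      finally have ER: "expectation (R N) \<le> (real J + 1) * (2 * \<delta> + D * card (range T) / sqrt N)" .
      \<comment> \<open>Markov's inequality for the nonnegative \<open>R N\<close> turns the
        expectation bound into a probability bound.\<close>
      have "measure M (?B N) \<le> measure M {\<omega>\<in>space M. \<kappa> / 3 \<le> R N \<omega>}"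
        using incl intR by (intro finite_measure_mono) auto
      also have "\<dots> \<le> expectation (R N) / (\<kappa> / 3)"
        using intR R0 \<kappa>(1) by (intro integral_Markov_inequality_measure[where A="{}"]) auto
      also have "\<dots> \<le> (real J + 1) * (2 * \<delta> + D * card (range T) / sqrt N) / (\<kappa> / 3)"
        using ER \<kappa>(1) by (intro divide_right_mono) auto
      finally show ?thesis .
    qed
    \<comment> \<open>\<open>T\<close> and \<open>D\<close> were fixed before \<open>N\<close>, so
      the sampling term vanishes as \<open>N\<close> grows and the bound tends to
      \<open>\<theta> / 2\<close>.\<close>
    have "filterlim (\<lambda>N. sqrt (real N)) at_top sequentially"
      by (rule filterlim_compose[OF sqrt_at_top filterlim_real_sequentially])
    then have "(\<lambda>N. D * card (range T) / sqrt N) \<longlonglongrightarrow> 0"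
      by (intro tendsto_divide_0[OF tendsto_const] filterlim_at_top_imp_at_infinity)
    then have "(\<lambda>N. (real J + 1) * (2 * \<delta> + D * card (range T) / sqrt N) / (\<kappa> / 3))
        \<longlonglongrightarrow> (real J + 1) * (2 * \<delta> + 0) / (\<kappa> / 3)"
      using \<kappa>(1) by (intro tendsto_intros) auto
    moreover have "(real J + 1) * (2 * \<delta> + 0) / (\<kappa> / 3) < \<theta>"
    proof -
      have eq: "(real J + 1) * (2 * \<delta> + 0) / (\<kappa> / 3) = \<theta> / 2"
        using \<kappa>(1) by (simp add: \<delta>_def divide_simps)
      show ?thesis unfolding eq using \<theta> by simp
    qed
    ultimately have "\<forall>\<^sub>F N in sequentially. (real J + 1) * (2 * \<delta> + D * card (range T) / sqrt N) / (\<kappa> / 3) < \<theta>"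
      by (rule order_tendstoD(2))
    then show "\<forall>\<^sub>F N in sequentially. measure M (?B N) < \<theta>"
      using eventually_ge_at_top[of 1]
    proof eventually_elim
      case (elim N)
      show ?case by (rule order.strict_trans1[OF bound[OF elim(2)] elim(1)])
    qed
  qed (simp add: order.strict_trans2[OF _ measure_nonneg])
qed

end
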